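(* For every prime number $p$, $3\le \operatorname{aw}(\mathbb{Z}_p,3)\le 4$. For every integer $n\ge 2$, \[\operatorname{aw}(\mathbb{Z}_n,3) = 2+f_2(n)+f_3(n)+2f_4(n).\] Moreover, for an integer $n\ge 2$ all of whose prime factors are less than $100$, $f_4(n)$ equals the number of odd prime factors of $n$ (counted with multiplicity) lying in $Q_4:=\{17, 31, 41, 43, 73, 89, 97\}$, and $f_3(n)$ equals the number of odd prime factors of $n$ (counted with multiplicity) lying in $Q_3$, the set of all odd primes less than $100$ not in $Q_4$.
   Context: $\mathbb{Z}_n$ is the cyclic group of integers modulo $n$. For a subset $S$ of $\mathbb{Z}_n$ and $k\ge 2$, a $k$-term arithmetic progression ($k$-AP) is a set of $k$ distinct elements of the form $a,a+d,\dots,a+(k-1)d$ (computed mod $n$) with $d\not\equiv 0$. An $r$-coloring of $S$ is a function $c:S\to\{1,\dots,r\}$; it is exact if surjective. A $k$-AP is rainbow if its elements receive $k$ distinct colors. $\operatorname{aw}(S,k)$ is the smallest $r$ such that every exact $r$-coloring of $S$ contains a rainbow $k$-AP (with $\operatorname{aw}(S,k)=|S|+1$ if $|S|<k$). For an integer $n\ge 2$: $f_2(n)=0$ if $n$ is odd and $1$ if $n$ is even; $f_3(n)$ is the number of odd prime factors $p$ of $n$ with $\operatorname{aw}(\mathbb{Z}_p,3)=3$, and $f_4(n)$ the number of odd prime factors $p$ of $n$ with $\operatorname{aw}(\mathbb{Z}_p,3)=4$, both counted with multiplicity. *)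

theory Defs
  imports "HOL-Computational_Algebra.Computational_Algebra"
begin

text \<open>Elements of $\mathbb{Z}_n$ are represented by their residues in $\{0,\dots,n-1\}$.\<close>

definition Zmod :: "nat \<Rightarrow> int set" where
  "Zmod n = {0..<int n}"

definition is_AP :: "nat \<Rightarrow> nat \<Rightarrow> int set \<Rightarrow> bool" where
  "is_AP n k A \<longleftrightarrow>
     (\<exists>a d. d mod int n \<noteq> 0 \<and> A = (\<lambda>i. (a + int i * d) mod int n) ` {..<k} \<and> card A = k)"

definition exact_coloring :: "int set \<Rightarrow> nat \<Rightarrow> (int \<Rightarrow> nat) \<Rightarrow> bool" where
  "exact_coloring S r c \<longleftrightarrow> c ` S = {1..r}"

definition rainbow :: "(int \<Rightarrow> nat) \<Rightarrow> int set \<Rightarrow> bool" where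
  "rainbow c A \<longleftrightarrow> inj_on c A"

text \<open>The restriction to \<open>r \<ge> 1\<close> is needed because a nonempty set has no colorings with \<open>0\<close>
  colors, so \<open>r = 0\<close> would satisfy the condition vacuously.\<close>

definition aw :: "nat \<Rightarrow> int set \<Rightarrow> nat \<Rightarrow> nat" where
  "aw n S k =
     (if card S < k then card S + 1
      else (LEAST r. r \<ge> 1 \<and>
              (\<forall>c. exact_coloring S r c \<longrightarrow> (\<exists>A \<subseteq> S. is_AP n k A \<and> rainbow c A))))"

definition f2 :: "nat \<Rightarrow> nat" where
  "f2 n = (if odd n then 0 else 1)"

definition f3 :: "nat \<Rightarrow> nat" where
  "f3 n = size {#p \<in># prime_factorization n. odd p \<and> aw p (Zmod p) 3 = 3#}"

definition f4 :: "nat \<Rightarrow> nat" where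
  "f4 n = size {#p \<in># prime_factorization n. odd p \<and> aw p (Zmod p) 3 = 4#}"

definition Q4 :: "nat set" where
  "Q4 = {17, 31, 41, 43, 73, 89, 97}"

definition Q3 :: "nat set" where
  "Q3 = {p. prime p \<and> odd p \<and> p < 100 \<and> p \<notin> Q4}"

end

theory Submission
  imports Defs "HOL-Number_Theory.Number_Theory"
begin

text \<open>
  Let $R(n)$ be the largest number of colors of a rainbow-free coloring of $\mathbb{Z}_n$, so that
  $\mathrm{aw}(\mathbb{Z}_n, 3) = R(n) + 1$. For odd $s, t$, let $P_i$ be the set of colors on the
  residue class $i$ modulo $s$ of a rainbow-free coloring of $\mathbb{Z}_{st}$, and let $P_m$ be
  largest. Every $P_i$ has at most one color outside $P_m$, and sending $i$ to that color (or to a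
  common extra color) is a rainbow-free coloring of $\mathbb{Z}_s$; hence
  $R(st) \le R(s) + R(t) - 1$. A factor $2^e$ with $e \ge 1$ adds at most one color. Conversely, a
  coloring of $\mathbb{Z}_p$ with at most three colors in which $0$ is alone in its class can be
  refined on the multiples of $p$, which adds $R(p) - 1$ colors.

  For a prime $p$ and a rainbow-free 3-coloring of $\mathbb{Z}_p$, call two colors adjacent at $d$ if
  they occur at some $x$ and $x + d$. For no $d$ are all three pairs of colors adjacent, and
  non-adjacency at $d$ is inherited by $-d$ and $2d$. Therefore there is no such coloring if
  $\pm 2^k$ runs through all units, and otherwise the set $U$ of differences at which two fixed
  colors are not adjacent gives a 3-coloring in which $0$ is alone. By Cauchy--Davenport $U$ has at
  most one element more than the third color class. Equality would produce a set $X$ with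
  $|X| \ge 2$ and $|X + U| = |X| + |U| - 1$; by symmetry of $U$ a minimal such $X$ satisfies
  $X = x + y - X$ for all distinct $x, y \in X$, so $|X| = 2$, which contradicts $2U = U$. Counting
  differences then shows that some color class is a singleton. Since no two classes can be
  singletons, merging colors shows $R(p) \le 3$.
\<close>

section \<open>Periodic colorings of the integers and the anti-van der Waerden number\<close>

text \<open>Colorings of Z_n are periodic functions on all of \<open>int\<close>, so that
  restricting to positions \<open>a + b * k\<close> gives a coloring again. Degenerate triples
  satisfy the condition automatically: positions that agree modulo the period have equal
  colors.\<close>

definition rainbow_free :: "(int \<Rightarrow> 'a) \<Rightarrow> bool" where
  "rainbow_free c \<longleftrightarrow> (\<forall>x y. c x = c y \<or> c y = c (2 * y - x) \<or> c x = c (2 * y - x))"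

definition periodic :: "int \<Rightarrow> (int \<Rightarrow> 'a) \<Rightarrow> bool" where
  "periodic n c \<longleftrightarrow> (\<forall>x. c (x mod n) = c x)"

text \<open>The set comprehension fixes the color type to \<open>nat\<close>;
  \<open>card_range_le_max_colors\<close> transfers the bound to every color type.\<close>

definition max_colors :: "nat \<Rightarrow> nat" where
  "max_colors n =
     Max {card (range c) |c :: int \<Rightarrow> nat. periodic (int n) c \<and> rainbow_free c}"

lemma rainbow_freeD:
  assumes "rainbow_free c" "x + z = 2 * y"
  shows "c x = c y \<or> c y = c z \<or> c x = c z"
proof -
  have "z = 2 * y - x" using assms(2) by simp
  then show ?thesis using assms(1) unfolding rainbow_free_def by blast
qed

lemma periodicD: "periodic n c \<Longrightarrow> [x = y] (mod n) \<Longrightarrow> c x = c y"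
  unfolding periodic_def cong_def by metis

lemma rainbow_free_modD:
  assumes "rainbow_free c" "periodic n c" "[x + z = 2 * y] (mod n)"
  shows "c x = c y \<or> c y = c z \<or> c x = c z"
proof -
  have "[2 * y - x = z] (mod n)"
    using assms(3) by (metis add_diff_cancel_left' cong_diff cong_refl cong_sym)
  then have "c (2 * y - x) = c z" using assms(2) periodicD by blast
  then show ?thesis using rainbow_freeD[OF assms(1), of x "2 * y - x" y] by simp
qed

lemma rainbow_free_affine:
  assumes "rainbow_free c"
  shows "rainbow_free (\<lambda>k. c (a + b * k))"
  unfolding rainbow_free_def
proof (intro allI)
  fix x y :: int
  show "c (a + b * x) = c (a + b * y) \<or> c (a + b * y) = c (a + b * (2 * y - x))
      \<or> c (a + b * x) = c (a + b * (2 * y - x))"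
    by (rule rainbow_freeD[OF assms]) (simp add: algebra_simps)
qed

lemma rainbow_free_comp: "rainbow_free c \<Longrightarrow> rainbow_free (\<lambda>x. h (c x))"
  unfolding rainbow_free_def by metis

lemma periodic_comp: "periodic n c \<Longrightarrow> periodic n (\<lambda>x. h (c x))"
  unfolding periodic_def by simp

lemma periodicI: "(\<And>x y. [x = y] (mod n) \<Longrightarrow> c x = c y) \<Longrightarrow> periodic n c"
  unfolding periodic_def using cong_mod_left cong_refl by blast

lemma periodic_affine:
  assumes "periodic (b * n) c"
  shows "periodic n (\<lambda>k. c (a + b * k))"
proof (rule periodicI)
  fix x y assume "[x = y] (mod n)"
  then have "[b * x = b * y] (mod (b * n))" by (simp add: cong_def)
  then have "[a + b * x = a + b * y] (mod (b * n))" by (rule cong_add[OF cong_refl])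
  then show "c (a + b * x) = c (a + b * y)" by (rule periodicD[OF assms])
qed

lemma range_periodic:
  assumes "periodic (int n) c" "n > 0"
  shows "range c = c ` {0..<int n}"
proof
  show "range c \<subseteq> c ` {0..<int n}"
  proof
    fix y assume "y \<in> range c"
    then obtain x where "y = c x" by blast
    then have "y = c (x mod int n)" using assms(1) by (simp add: periodic_def)
    then show "y \<in> c ` {0..<int n}" using assms(2) by auto
  qed
qed auto

lemma finite_range_periodic: "periodic (int n) c \<Longrightarrow> n > 0 \<Longrightarrow> finite (range c)"
  using range_periodic[of n c] by simp

lemma card_range_periodic:
  assumes "periodic (int n) c" "n > 0"
  shows "card (range c) \<le> n"
proof -
  have "card (c ` {0..<int n}) \<le> card {0..<int n}" by (rule card_image_le) simp
  then show ?thesis using range_periodic[OF assms] by simp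
qed

lemma max_colors_set:
  fixes n :: nat
  assumes "n > 0"
  defines "S \<equiv> {card (range c) |c :: int \<Rightarrow> nat. periodic (int n) c \<and> rainbow_free c}"
  shows "finite S" "S \<noteq> {}"
proof -
  have "S \<subseteq> {..n}" unfolding S_def using card_range_periodic assms(1) by blast
  then show "finite S" using finite_subset by blast
  have "periodic (int n) (\<lambda>_. 0::nat)" "rainbow_free (\<lambda>_. 0::nat)"
    by (simp_all add: periodic_def rainbow_free_def)
  then show "S \<noteq> {}" unfolding S_def by blast
qed

text \<open>The finite range of \<open>c\<close> embeds into \<open>nat\<close>. Freedom in the
  color type is used for colorings with values in \<open>bool\<close>, option and sum types.\<close>

lemma card_range_le_max_colors:
  fixes c :: "int \<Rightarrow> 'a"
  assumes "periodic (int n) c" "rainbow_free c" "n > 0"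
  shows "card (range c) \<le> max_colors n"
proof -
  obtain h :: "'a \<Rightarrow> nat" where h: "inj_on h (range c)"
    using finite_range_periodic[OF assms(1,3)] finite_imp_inj_to_nat_seg by blast
  have "card (range (\<lambda>x. h (c x))) = card (range c)"
    using card_image[OF h] by (simp add: image_image)
  moreover have "periodic (int n) (\<lambda>x. h (c x))" "rainbow_free (\<lambda>x. h (c x))"
    using assms periodic_comp rainbow_free_comp by blast+
  ultimately show ?thesis
    unfolding max_colors_def using max_colors_set(1)[OF assms(3)] by (intro Max_ge) (simp, force)
qed

lemma obtain_max_coloring:
  assumes "n > 0"
  obtains c :: "int \<Rightarrow> nat"
  where "periodic (int n) c" "rainbow_free c" "card (range c) = max_colors n"
  using Max_in[OF max_colors_set[OF assms]] unfolding max_colors_def by auto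

text \<open>Number the colors of an optimal coloring and merge all colors from \<open>r\<close> on
  by \<open>min r\<close>; merging keeps a coloring rainbow-free. Hence the attainable numbers of
  colors have no gaps.\<close>

lemma obtain_coloring:
  fixes r n :: nat
  assumes "n > 0" "0 < r" "r \<le> max_colors n"
  obtains c :: "int \<Rightarrow> nat" where "periodic (int n) c" "rainbow_free c" "range c = {1..r}"
proof -
  obtain c :: "int \<Rightarrow> nat"
    where c: "periodic (int n) c" "rainbow_free c" "card (range c) = max_colors n"
    using obtain_max_coloring[OF assms(1)] by blast
  obtain h where h: "bij_betw h (range c) {1..max_colors n}"
    using finite_same_card_bij[OF finite_range_periodic[OF c(1) assms(1)], of "{1..max_colors n}"] c(3)
    by auto
  have "(\<lambda>x. min r (h x)) ` range c = min r ` {1..max_colors n}"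
    using h unfolding bij_betw_def by (metis image_image)
  also have "\<dots> = {1..r}"
  proof
    show "{1..r} \<subseteq> min r ` {1..max_colors n}"
    proof
      fix x assume "x \<in> {1..r}"
      then show "x \<in> min r ` {1..max_colors n}"
        using assms by (intro image_eqI[of _ _ x]) auto
    qed
  qed (use assms in auto)
  finally have "range (\<lambda>x. min r (h (c x))) = {1..r}" by (simp add: image_image)
  with that[of "\<lambda>x. min r (h (c x))"] c show thesis
    using periodic_comp[of _ c "\<lambda>x. min r (h x)"] rainbow_free_comp[of c "\<lambda>x. min r (h x)"] by blast
qed

lemma max_colors_ge_1: "n > 0 \<Longrightarrow> max_colors n \<ge> 1"
  using card_range_le_max_colors[of n "\<lambda>_. True"] by (simp add: periodic_def rainbow_free_def)

lemma max_colors_le: "n > 0 \<Longrightarrow> max_colors n \<le> n"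
proof -
  assume n: "n > 0"
  obtain c :: "int \<Rightarrow> nat" where "periodic (int n) c" "card (range c) = max_colors n"
    using obtain_max_coloring[OF n] by blast
  then show ?thesis using card_range_periodic[OF _ n, of c] by simp
qed

text \<open>Modulo 1 and 2 the positions \<open>x\<close> and \<open>2 * y - x\<close> coincide, so
  the coloring by residues is rainbow-free.\<close>

lemma max_colors_small:
  assumes "0 < n" "n < 3"
  shows "max_colors n = n"
proof -
  let ?c = "\<lambda>x::int. x mod int n"
  have "rainbow_free ?c"
  proof (cases "n = 1")
    case False
    then have "n = 2" using assms by simp
    then show ?thesis unfolding rainbow_free_def by (simp, presburger)
  qed (simp add: rainbow_free_def)
  moreover have "periodic (int n) ?c" by (simp add: periodic_def)
  moreover have "range ?c = {0..<int n}"
    using range_periodic[OF \<open>periodic (int n) ?c\<close> assms(1)] by auto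
  ultimately show ?thesis
    using card_range_le_max_colors[of n ?c] max_colors_le[of n] assms by simp
qed

text \<open>For \<open>n < 3\<close> the default \<open>card S + 1\<close> in \<open>aw\<close>
  agrees with \<open>max_colors_small\<close>. Otherwise \<open>max_colors n + 1\<close> colors
  force a rainbow progression, and \<open>obtain_coloring\<close> refutes every smaller positive
  \<open>r\<close>.\<close>

lemma aw_eq_max_colors:
  assumes "n > 0"
  shows "aw n (Zmod n) 3 = max_colors n + 1"
proof (cases "n < 3")
  case True
  then show ?thesis using assms max_colors_small by (simp add: aw_def Zmod_def)
next
  case False
  let ?P = "\<lambda>r. r \<ge> 1 \<and> (\<forall>c. exact_coloring (Zmod n) r c \<longrightarrow>
              (\<exists>A \<subseteq> Zmod n. is_AP n 3 A \<and> rainbow c A))"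
  have im3: "f ` {..<3::nat} = {f 0, f 1, f 2}" for f :: "nat \<Rightarrow> int"
    by (auto simp: eval_nat_numeral lessThan_Suc)
  have "(LEAST r. ?P r) = max_colors n + 1"
  proof (rule Least_equality)
    show "?P (max_colors n + 1)"
    proof (intro conjI allI impI)
      fix c assume ex: "exact_coloring (Zmod n) (max_colors n + 1) c"
      \<comment> \<open>Exactness controls \<open>c\<close> on residues only; \<open>?c\<close> is
        the periodic extension.\<close>
      let ?c = "\<lambda>x. c (x mod int n)"
      have per: "periodic (int n) ?c" by (simp add: periodic_def)
      have "range ?c = ?c ` {0..<int n}" using range_periodic[OF per assms] .
      also have "\<dots> = c ` Zmod n" unfolding Zmod_def by (intro image_cong) auto
      finally have "card (range ?c) = max_colors n + 1" using ex by (simp add: exact_coloring_def)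
      then have "\<not> rainbow_free ?c" using card_range_le_max_colors[OF per _ assms] by auto
      then obtain x y where xy: "?c x \<noteq> ?c y" "?c y \<noteq> ?c (2 * y - x)" "?c x \<noteq> ?c (2 * y - x)"
        unfolding rainbow_free_def by blast
      let ?A = "{x mod int n, y mod int n, (2 * y - x) mod int n}"
      have "?A = (\<lambda>i. (x + int i * (y - x)) mod int n) ` {..<3}"
        unfolding im3 by (simp add: algebra_simps)
      moreover have "(y - x) mod int n \<noteq> 0"
      proof
        assume "(y - x) mod int n = 0"
        then have "y mod int n = x mod int n" by (simp add: mod_eq_dvd_iff mod_0_imp_dvd)
        then show False using xy by simp
      qed
      moreover have "card ?A = 3"
      proof -
        have "x mod int n \<noteq> y mod int n" "y mod int n \<noteq> (2 * y - x) mod int n"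
          "x mod int n \<noteq> (2 * y - x) mod int n" using xy by auto
        then show ?thesis by simp
      qed
      ultimately have "is_AP n 3 ?A" unfolding is_AP_def by blast
      moreover have "?A \<subseteq> Zmod n" using assms by (auto simp: Zmod_def)
      moreover have "rainbow c ?A" using xy unfolding rainbow_def inj_on_def by auto
      ultimately show "\<exists>A \<subseteq> Zmod n. is_AP n 3 A \<and> rainbow c A" by blast
    qed simp
  next
    fix r assume r: "?P r"
    show "max_colors n + 1 \<le> r"
    proof (rule ccontr)
      assume "\<not> max_colors n + 1 \<le> r"
      then obtain c :: "int \<Rightarrow> nat"
        where c: "periodic (int n) c" "rainbow_free c" "range c = {1..r}"
        using obtain_coloring[OF assms, of r] r by auto
      have "exact_coloring (Zmod n) r c"
        using range_periodic[OF c(1) assms] c(3) by (simp add: exact_coloring_def Zmod_def)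
      then obtain A where A: "is_AP n 3 A" "rainbow c A" using r by blast
      then obtain a d where "A = (\<lambda>i. (a + int i * d) mod int n) ` {..<3}" "card A = 3"
        unfolding is_AP_def by blast
      then have A3: "A = {a mod int n, (a + d) mod int n, (a + 2 * d) mod int n}"
        and card3: "card A = 3" unfolding im3 by simp_all
      have "card (c ` A) = 3" using A(2) card3 card_image unfolding rainbow_def by metis
      moreover have "c ` A = {c a, c (a + d), c (a + 2 * d)}"
        using c(1) unfolding A3 periodic_def by simp
      ultimately have "c a \<noteq> c (a + d)" "c (a + d) \<noteq> c (a + 2 * d)" "c a \<noteq> c (a + 2 * d)"
        by (auto simp: card_insert_if split: if_splits)
      then show False using rainbow_freeD[OF c(2), of a "a + 2 * d" "a + d"] by simp
    qed
  qed
  then show ?thesis using False by (simp add: aw_def Zmod_def)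
qed

section \<open>Products of moduli\<close>

text \<open>For \<open>n = 2 * m + 1\<close> the number \<open>m + 1\<close> is an inverse of 2
  modulo \<open>n\<close>.\<close>

lemma odd_cong_midpoint:
  fixes n :: int
  assumes "odd n"
  obtains y where "[x + z = 2 * y] (mod n)"
proof -
  obtain m where m: "n = 2 * m + 1" using assms by (elim oddE)
  have "2 * ((x + z) * (m + 1)) = (x + z) + (x + z) * n" using m by (simp add: algebra_simps)
  then have "[x + z = 2 * ((x + z) * (m + 1))] (mod n)" by (simp add: cong_def)
  then show thesis using that by blast
qed

lemma cong_double_cancel:
  fixes n :: int
  assumes "odd n" "[2 * x = 2 * y] (mod n)"
  shows "[x = y] (mod n)"
  using assms by (simp add: cong_mult_lcancel)

lemma card_ge_2_obtain:
  assumes "\<not> card S \<le> 1"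
  obtains x y where "x \<in> S" "y \<in> S" "x \<noteq> y"
  using assms by (metis One_nat_def card_le_Suc0_iff_eq card.infinite le0)

text \<open>For residue classes in progression, any colors chosen on two of them are completed by a
  color of the third class; \<open>outer\<close> and \<open>middle\<close> are the two forms of
  this. They make the sets \<open>P i\<close> almost nested.\<close>

lemma max_colors_mult_odd_le:
  assumes "odd s" "odd t"
  shows "max_colors (s * t) + 1 \<le> max_colors s + max_colors t"
proof -
  have pos: "s > 0" "t > 0" "s * t > 0" using assms by (auto intro: odd_pos)
  obtain c :: "int \<Rightarrow> nat" where c: "periodic (int (s * t)) c" "rainbow_free c"
    "card (range c) = max_colors (s * t)"
    using obtain_max_coloring[OF pos(3)] by blast
  define P where "P i = c ` {x. [x = i] (mod int s)}" for i
  have P_range: "P i = range (\<lambda>k. c (i + int s * k))" for i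
    unfolding P_def
  proof (intro equalityI subsetI)
    fix y assume "y \<in> c ` {x. [x = i] (mod int s)}"
    then obtain x where x: "y = c x" "[x = i] (mod int s)" by blast
    then obtain k where "x = i + int s * k"
      by (metis cong_iff_lin cong_sym)
    then show "y \<in> range (\<lambda>k. c (i + int s * k))" using x by blast
  next
    fix y assume "y \<in> range (\<lambda>k. c (i + int s * k))"
    then show "y \<in> c ` {x. [x = i] (mod int s)}" by (auto simp: cong_def)
  qed
  have P_fin: "finite (P i)" and P_card: "card (P i) \<le> max_colors t" for i
  proof -
    have per: "periodic (int t) (\<lambda>k. c (i + int s * k))"
      using periodic_affine[of "int s" "int t" c i] c(1) by simp
    show "finite (P i)" unfolding P_range by (rule finite_range_periodic[OF per pos(2)])
    show "card (P i) \<le> max_colors t" unfolding P_range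
      by (rule card_range_le_max_colors[OF per rainbow_free_affine[OF c(2)] pos(2)])
  qed
  have P_ne: "P i \<noteq> {}" for i unfolding P_range by simp
  have P_cong: "P i = P j" if "[i = j] (mod int s)" for i j
    unfolding P_def using that by (metis (no_types, opaque_lifting) cong_sym cong_trans)
  have outer: "\<exists>u\<in>P k. a = b \<or> b = u \<or> a = u" if "a \<in> P i" "b \<in> P j" "i + k = 2 * j" for a b i j k
  proof -
    obtain x y where xy: "a = c x" "[x = i] (mod int s)" "b = c y" "[y = j] (mod int s)"
      using \<open>a \<in> P i\<close> \<open>b \<in> P j\<close> unfolding P_def by blast
    have "[2 * y - x = 2 * j - i] (mod int s)"
      using xy cong_diff cong_scalar_left by blast
    moreover have "k = 2 * j - i" using \<open>i + k = 2 * j\<close> by simp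
    ultimately have "[2 * y - x = k] (mod int s)" by simp
    then have "c (2 * y - x) \<in> P k" unfolding P_def by blast
    then show ?thesis using rainbow_freeD[OF c(2), of x "2 * y - x" y] xy by auto
  qed
  \<comment> \<open>The middle position is a midpoint modulo \<open>s * t\<close>, which exists
    because \<open>s * t\<close> is odd.\<close>
  have middle: "\<exists>u\<in>P j. a = b \<or> b = u \<or> a = u" if "a \<in> P i" "b \<in> P k" "i + k = 2 * j" for a b i j k
  proof -
    obtain x z where xz: "a = c x" "[x = i] (mod int s)" "b = c z" "[z = k] (mod int s)"
      using \<open>a \<in> P i\<close> \<open>b \<in> P k\<close> unfolding P_def by blast
    obtain y where y: "[x + z = 2 * y] (mod int (s * t))"
      using odd_cong_midpoint[of "int (s * t)"] assms by auto
    then have "[x + z = 2 * y] (mod int s)" by (simp add: cong_modulus_mult)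
    moreover have "[x + z = 2 * j] (mod int s)" using xz \<open>i + k = 2 * j\<close> cong_add by metis
    ultimately have "[2 * y = 2 * j] (mod int s)" using cong_sym cong_trans by blast
    then have "[y = j] (mod int s)" using cong_double_cancel assms(1) by simp
    then have "c y \<in> P j" unfolding P_def by blast
    then show ?thesis using rainbow_free_modD[OF c(2,1) y] xz by auto
  qed
  have reflect_outer: "P (2 * i - j) \<subseteq> P j"
    \<comment> \<open>A color \<open>u\<close> outside \<open>P j\<close> would have to equal both
      \<open>a\<close> and \<open>b\<close>.\<close>
    if "a \<in> P i" "b \<in> P i" "a \<noteq> b" "a \<notin> P j" "b \<notin> P j" for a b i j
  proof
    fix u assume u: "u \<in> P (2 * i - j)"
    from outer[OF u \<open>a \<in> P i\<close>, of j] outer[OF u \<open>b \<in> P i\<close>, of j] show "u \<in> P j"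
      using that by auto
  qed
  have reflect_middle: "P (2 * j - i) \<subseteq> P j"
    if "a \<in> P i" "b \<in> P i" "a \<noteq> b" "a \<notin> P j" "b \<notin> P j" for a b i j
  proof
    fix u assume u: "u \<in> P (2 * j - i)"
    from middle[OF u \<open>a \<in> P i\<close>, of j] middle[OF u \<open>b \<in> P i\<close>, of j] show "u \<in> P j"
      using that by auto
  qed
  have no_cross: False
    if ab: "a \<in> P i" "b \<in> P i" "a \<noteq> b" "a \<notin> P j" "b \<notin> P j"
      and de: "d \<in> P j" "e \<in> P j" "d \<noteq> e" "d \<notin> P i" "e \<notin> P i" for a b d e i j
  proof -
    \<comment> \<open>Reflecting \<open>j\<close> in \<open>i\<close> and back shows that
      \<open>P (2 * i - j)\<close> equals \<open>P j\<close>; \<open>reflect_middle\<close> with the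
      colors \<open>d\<close> and \<open>e\<close> then puts it inside \<open>P i\<close>.\<close>
    have sub: "P (2 * i - j) \<subseteq> P j" using reflect_outer[OF ab] .
    then have "P (2 * i - (2 * i - j)) \<subseteq> P (2 * i - j)"
      using ab by (intro reflect_outer[of a i b]) auto
    then have "P j \<subseteq> P (2 * i - j)" by simp
    also have "\<dots> \<subseteq> P i" using reflect_middle[OF de] .
    finally show False using de by blast
  qed
  define m where "m = (ARG_MAX (\<lambda>i. card (P i)) i. True)"
  have m: "card (P i) \<le> card (P m)" for i
    unfolding m_def by (rule arg_max_nat_le[where b = "Suc (max_colors t)"])
      (use P_card in \<open>auto simp: less_Suc_eq_le\<close>)
  \<comment> \<open>If \<open>P i\<close> had two colors outside \<open>P m\<close>, then
    \<open>P m\<close>, being at least as large, would have two colors outside \<open>P i\<close>,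
    against \<open>no_cross\<close>.\<close>
  have diff1: "card (P i - P m) \<le> 1" for i
  proof (rule ccontr)
    assume *: "\<not> card (P i - P m) \<le> 1"
    have "card (P i - P m) + card (P i \<inter> P m) = card (P i)"
      using card_Diff_subset_Int[of "P i" "P m"] P_fin card_mono[of "P i" "P i \<inter> P m"] by simp
    moreover have "card (P m - P i) + card (P i \<inter> P m) = card (P m)"
      using card_Diff_subset_Int[of "P m" "P i"] P_fin card_mono[of "P m" "P i \<inter> P m"]
      by (simp add: Int_commute)
    ultimately have **: "\<not> card (P m - P i) \<le> 1" using m[of i] * by linarith
    from * ** show False
      by (elim card_ge_2_obtain) (use no_cross in blast)
  qed
  \<comment> \<open>\<open>None\<close> is the common extra color. In the other case
    \<open>diff1\<close> makes the description under \<open>THE\<close> unique.\<close>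
  define q where "q i = (if P i \<subseteq> P m then None else Some (THE a. a \<in> P i - P m))" for i
  have q_Some: "P i - P m = {a}" if "q i = Some a" for i a
  proof -
    have "P i - P m \<noteq> {}" using that unfolding q_def by (auto split: if_splits)
    then have "card (P i - P m) = 1" using diff1[of i] P_fin by (simp add: le_Suc_eq)
    then obtain b where b: "P i - P m = {b}" by (rule card_1_singletonE)
    then have "q i = Some b" unfolding q_def by auto
    then show ?thesis using that b by simp
  qed
  have q_None: "P i \<subseteq> P m" if "q i = None" for i
    using that unfolding q_def by (auto split: if_splits)
  have "periodic (int s) q"
    by (rule periodicI) (metis P_cong q_def)
  \<comment> \<open>Among three distinct values of \<open>q\<close>, two are distinct colors outside
    \<open>P m\<close>; the remaining class must contain one of them, and so cannot have a third
    value.\<close>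
  moreover have "rainbow_free q"
    unfolding rainbow_free_def
  proof (rule ccontr)
    assume "\<not> (\<forall>x y. q x = q y \<or> q y = q (2 * y - x) \<or> q x = q (2 * y - x))"
    then obtain i j k where ijk: "i + k = 2 * j" and ne: "q i \<noteq> q j" "q j \<noteq> q k" "q i \<noteq> q k"
      by (metis diff_add_cancel)
    show False
    proof (cases "q j")
      case None
      then obtain a b where "q i = Some a" "q k = Some b" using ne by fastforce
      then have *: "P i - P m = {a}" "P k - P m = {b}" using q_Some by auto
      have "a \<noteq> b" using ne \<open>q i = Some a\<close> \<open>q k = Some b\<close> by auto
      with middle[of a i b k j] ijk * q_None[OF None] show False by auto
    next
      case (Some b)
      then have b: "P j - P m = {b}" using q_Some by auto
      show False
      proof (cases "q i")
        case None
        then obtain a where "q k = Some a" using ne by fastforce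
        then have a: "P k - P m = {a}" using q_Some by auto
        have "a \<noteq> b" using ne Some \<open>q k = Some a\<close> by auto
        with outer[of a k b j i] ijk a b q_None[OF None] show False by auto
      next
        case (Some a)
        then have a: "P i - P m = {a}" using q_Some by auto
        have "a \<noteq> b" using ne Some \<open>q j = Some b\<close> by auto
        with outer[of a i b j k] ijk a b obtain u where u: "u \<in> P k - P m" "u = a \<or> u = b"
          by blast
        then have "q k \<noteq> None" using q_None by blast
        then obtain d where "q k = Some d" by blast
        then have "u = d" using q_Some u by auto
        then show False using u ne Some \<open>q j = Some b\<close> \<open>q k = Some d\<close> by auto
      qed
    qed
  qed
  ultimately have q: "finite (range q)" "card (range q) \<le> max_colors s"
    using finite_range_periodic card_range_le_max_colors pos(1) by blast+
  have "range c \<subseteq> P m \<union> the ` (range q - {None})"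
  proof
    fix a assume "a \<in> range c"
    then obtain x where x: "a = c x" by blast
    then have a: "a \<in> P x" unfolding P_def by auto
    show "a \<in> P m \<union> the ` (range q - {None})"
    proof (cases "q x")
      case None
      then show ?thesis using q_None a by blast
    next
      case (Some b)
      then have "a \<in> P m \<or> a = b" using q_Some a by blast
      then show ?thesis using Some by (metis DiffI UnCI imageI option.sel option.simps(3) rangeI singletonD)
    qed
  qed
  then have "card (range c) \<le> card (P m \<union> the ` (range q - {None}))"
    using P_fin q(1) by (intro card_mono) auto
  also have "\<dots> \<le> card (P m) + card (the ` (range q - {None}))" by (rule card_Un_le)
  also have "\<dots> \<le> max_colors t + card (range q - {None})"
    using P_card[of m] card_image_le[of "range q - {None}" the] q(1) by (simp add: add_mono)
  also have "card (range q - {None}) = card (range q) - 1"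
  proof -
    \<comment> \<open>The value \<open>None\<close> is taken at \<open>m\<close>, which accounts for
      the one color saved in the bound.\<close>
    have "q m = None" by (simp add: q_def)
    then have "None \<in> range q" by (metis rangeI)
    then show ?thesis using q(1) by simp
  qed
  finally show ?thesis using q c(3) max_colors_ge_1[OF pos(1)] by linarith
qed

text \<open>Two odd positions have two midpoints modulo \<open>2 * s\<close>, which differ by the
  odd number \<open>s\<close>, so one of them is even. Two colors missing on the even positions
  would form a rainbow progression with it.\<close>

lemma max_colors_double_odd_le:
  assumes "odd s"
  shows "max_colors (2 * s) \<le> max_colors s + 1"
proof -
  have pos: "s > 0" "2 * s > 0" using assms by (auto intro: odd_pos)
  obtain c :: "int \<Rightarrow> nat" where c: "periodic (int (2 * s)) c" "rainbow_free c"
    "card (range c) = max_colors (2 * s)"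
    using obtain_max_coloring[OF pos(2)] by blast
  let ?E = "range (\<lambda>k. c (0 + 2 * k))" and ?O = "range (\<lambda>k. c (1 + 2 * k))"
  have per: "periodic (int s) (\<lambda>k. c (a + 2 * k))" for a
    using periodic_affine[of 2 "int s" c a] c(1) by simp
  have E: "card ?E \<le> max_colors s"
    by (rule card_range_le_max_colors[OF per rainbow_free_affine[OF c(2)] pos(1)])
  have O: "card (?O - ?E) \<le> 1"
  proof (rule ccontr)
    assume "\<not> card (?O - ?E) \<le> 1"
    then obtain a b where ab: "a \<in> ?O - ?E" "b \<in> ?O - ?E" "a \<noteq> b" by (rule card_ge_2_obtain)
    then obtain i j where ij: "a = c (1 + 2 * i)" "b = c (1 + 2 * j)" by blast
    define y where "y = (if even (1 + i + j) then 1 + i + j else 1 + i + j + int s)"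
    have "even y" unfolding y_def using assms by auto
    then have "c y \<in> ?E" by (auto elim!: evenE)
    moreover have "2 * y = 1 + 2 * i + (1 + 2 * j) \<or> 2 * y = 1 + 2 * i + (1 + 2 * j) + int (2 * s)"
      unfolding y_def by auto
    then have "[1 + 2 * i + (1 + 2 * j) = 2 * y] (mod int (2 * s))"
      unfolding cong_def by (metis mod_add_self2)
    then have "c (1 + 2 * i) = c y \<or> c y = c (1 + 2 * j) \<or> c (1 + 2 * i) = c (1 + 2 * j)"
      by (rule rainbow_free_modD[OF c(2,1)])
    ultimately show False using ab ij by auto
  qed
  have "range c \<subseteq> ?E \<union> (?O - ?E)"
  proof
    fix a assume "a \<in> range c"
    then obtain x where x: "a = c x" by blast
    show "a \<in> ?E \<union> (?O - ?E)"
    proof (cases "even x")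
      case True
      then show ?thesis using x by (auto elim!: evenE)
    next
      case False
      then obtain k where "x = 1 + 2 * k" by (metis add.commute oddE)
      then show ?thesis using x by blast
    qed
  qed
  then have "card (range c) \<le> card (?E \<union> (?O - ?E))"
    by (intro card_mono finite_UnI finite_Diff finite_range_periodic[OF per pos(1)])
  also have "\<dots> \<le> card ?E + card (?O - ?E)" by (rule card_Un_le)
  finally show ?thesis using E O c(3) by linarith
qed


text \<open>The loss is one color for the whole power of 2, so doubling cannot simply be iterated.
  If the colors of one parity class contain those of the other, the induction hypothesis for that
  class suffices; otherwise all colors but one are found on a coset that is colored modulo
  \<open>s\<close>.\<close>

lemma max_colors_power2_mult_le:
  assumes "odd s"
  shows "max_colors (2 ^ Suc e * s) \<le> max_colors s + 1"
proof (induction e)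
  case 0
  then show ?case using max_colors_double_odd_le[OF assms] by simp
next
  case (Suc e)
  define n where "n = 2 ^ Suc e * s"
  define q :: int where "q = 2 ^ Suc (Suc e)"
  have n2: "2 ^ Suc (Suc e) * s = 2 * n" by (simp add: n_def)
  have pos: "s > 0" "n > 0" "2 * n > 0" using assms by (auto intro: odd_pos simp: n_def)
  obtain c :: "int \<Rightarrow> nat" where c: "periodic (int (2 * n)) c" "rainbow_free c"
    "card (range c) = max_colors (2 * n)"
    using obtain_max_coloring[OF pos(3)] by blast
  let ?C = "\<lambda>a. range (\<lambda>k. c (a + 2 * k))"
  have per: "periodic (int n) (\<lambda>k. c (a + 2 * k))" for a
    using periodic_affine[of 2 "int n" c a] c(1) by simp
  have C: "card (?C a) \<le> max_colors s + 1" for a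
    using card_range_le_max_colors[OF per rainbow_free_affine[OF c(2)] pos(2), of a] Suc
    by (simp add: n_def)
  have C_iff: "c x \<in> ?C x" "[x = y] (mod 2) \<Longrightarrow> ?C x = ?C y" for x y
  proof -
    show "c x \<in> ?C x" by (rule range_eqI[of _ _ 0]) simp
    show "?C x = ?C y" if xy: "[x = y] (mod 2)"
    proof -
      have "2 dvd y - x" using xy cong_sym cong_iff_dvd_diff by blast
      then obtain m where "y = x + 2 * m" by (metis add.commute diff_add_cancel dvdE)
      then have "c (y + 2 * k) = c (x + 2 * (k + m))" "c (x + 2 * k) = c (y + 2 * (k - m))" for k
        by (simp_all add: algebra_simps)
      then have "?C x \<subseteq> ?C y" "?C y \<subseteq> ?C x" by (metis image_subsetI rangeI)+
      then show ?thesis by blast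
    qed
  qed
  have all: "range c \<subseteq> ?C 0 \<union> ?C 1"
  proof
    fix a assume "a \<in> range c"
    then obtain x where x: "a = c x" by blast
    have "[x = 0] (mod 2) \<or> [x = 1] (mod 2)" by (auto simp: cong_def)
    then show "a \<in> ?C 0 \<union> ?C 1" using C_iff[of x] x by blast
  qed
  have fin: "finite (?C a)" for a using finite_range_periodic[OF per pos(2)] .
  show ?case
  proof (cases "?C 0 \<subseteq> ?C 1 \<or> ?C 1 \<subseteq> ?C 0")
    case True
    then have "range c \<subseteq> ?C 1 \<or> range c \<subseteq> ?C 0" using all by blast
    then have "card (range c) \<le> card (?C 1) \<or> card (range c) \<le> card (?C 0)"
      using card_mono[OF fin] by blast
    then show ?thesis unfolding n2 using C[of 0] C[of 1] c(3) by linarith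
  next
    case False
    \<comment> \<open>Some color occurs only on even, another one only on odd positions. All colors except the
      latter then occur on a coset of the multiples of \<open>q\<close>.\<close>
    then obtain i j where ij: "c (0 + 2 * i) \<notin> ?C 1" "c (1 + 2 * j) \<notin> ?C 0" by blast
    \<comment> \<open>Recentring at \<open>x0\<close> makes \<open>f 0\<close> a color of even
      positions only and \<open>f w\<close> a color of odd positions only.\<close>
    define x0 w where "x0 = 2 * i" and "w = 1 + 2 * j - 2 * i"
    have w: "odd w" by (simp add: w_def)
    define f where "f x = c (x0 + x)" for x
    have "?C x0 = ?C 0" "?C (x0 + 1) = ?C 1"
      by (rule C_iff(2), simp add: x0_def cong_def)+
    moreover have "f 0 = c (0 + 2 * i)" "f w = c (1 + 2 * j)"
      by (simp_all add: f_def x0_def w_def)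
    ultimately have f0: "f 0 \<notin> ?C (x0 + 1)" and fw: "f w \<notin> ?C x0" using ij by simp_all
    have rf: "rainbow_free f" using rainbow_free_affine[OF c(2), of x0 1] by (simp add: f_def[abs_def])
    have f_odd: "f x \<noteq> f 0" if "odd x" for x
    proof -
      have "?C (x0 + x) = ?C (x0 + 1)" using that by (intro C_iff(2)) (simp add: cong_def mod2_eq_if)
      then show ?thesis using f0 C_iff(1)[of "x0 + x"] unfolding f_def by auto
    qed
    have f_even: "f x \<noteq> f w" if "even x" for x
    proof -
      have "?C (x0 + x) = ?C x0" using that by (intro C_iff(2)) (simp add: cong_def mod2_eq_if)
      then show ?thesis using fw C_iff(1)[of "x0 + x"] unfolding f_def by auto
    qed
    \<comment> \<open>Two consecutive multiples of \<open>w\<close> have different colors, the next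
      one must repeat one of these, and parity decides which.\<close>
    have mult: "f (int k * w) = (if even k then f 0 else f w)" for k :: nat
    proof (induction k rule: less_induct)
      case (less k)
      consider "k = 0" | "k = 1" | m where "k = m + 2" by (metis One_nat_def add_2_eq_Suc' not0_implies_Suc)
      then show ?case
      proof cases
        case 3
        have m: "f (int m * w) = (if even m then f 0 else f w)"
          and m1: "f (int (m + 1) * w) = (if even m then f w else f 0)"
          using less[of m] less[of "m + 1"] 3 by auto
        have "f (int m * w) = f (int (m + 1) * w) \<or> f (int (m + 1) * w) = f (int k * w)
            \<or> f (int m * w) = f (int k * w)"
          using 3 by (intro rainbow_freeD[OF rf]) (simp add: algebra_simps)
        then show ?thesis using m m1 f_odd[OF w] 3 w f_odd[of "int k * w"] f_even[of "int k * w"]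
          by (cases "even m") auto
      qed auto
    qed
    \<comment> \<open>An odd multiple of \<open>w\<close> has the color \<open>f w\<close>, which no
      even position has, so reflecting an even position in it keeps the color.\<close>
    have reflect: "f (2 * (int k * w) - z) = f z" if "even z" "odd k" "f z \<noteq> f w" for z k
      using rainbow_freeD[OF rf, of z "2 * (int k * w) - z" "int k * w"] mult[of k] that
        f_even[of "2 * (int k * w) - z"] by auto
    \<comment> \<open>The reflections in \<open>w\<close> and in \<open>(2 * k + 1) * w\<close>
      compose to this translation.\<close>
    have shift: "f (z + 4 * int k * w) = f z" if "even z" "f z \<noteq> f w" for z k
    proof -
      have "f (2 * (int (2 * k + 1) * w) - (2 * (int 1 * w) - z)) = f (2 * (int 1 * w) - z)"
        using that reflect[of z 1] by (intro reflect) auto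
      also have "\<dots> = f z" using that by (intro reflect) auto
      finally show ?thesis by (simp add: algebra_simps)
    qed
    \<comment> \<open>As \<open>w\<close> is invertible modulo \<open>2 ^ e\<close>, a translation
      by some \<open>4 * k * w\<close> moves a multiple of 4 to a multiple of \<open>q\<close>,
      which is \<open>4 * 2 ^ e\<close>.\<close>
    have four: "\<exists>m. f (q * m) = f z" if z4: "4 dvd z" and zw: "f z \<noteq> f w" for z
    proof -
      obtain u where u: "z = 4 * u" using z4 by blast
      have "coprime w (2 ^ e)" using w by simp
      then obtain v where v: "[w * v = 1] (mod 2 ^ e)" using cong_solve_coprime_int by blast
      define k where "k = nat ((- u * v) mod 2 ^ e)"
      have k: "int k = (- u * v) mod 2 ^ e" by (simp add: k_def)
      have "[u + int k * w = u + (- u * v) * w] (mod 2 ^ e)"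
        unfolding k by (intro cong_add cong_mult cong_refl) (simp add: cong_def)
      moreover have "[u + (- u) * (w * v) = u + (- u) * 1] (mod 2 ^ e)"
        by (intro cong_add cong_mult cong_refl v)
      ultimately have "[u + int k * w = 0] (mod 2 ^ e)"
        using cong_trans by (fastforce simp: algebra_simps)
      then obtain m where "u + int k * w = 2 ^ e * m" by (auto simp: cong_0_iff)
      then have "z + 4 * int k * w = q * m" using u by (simp add: q_def algebra_simps)
      then show ?thesis using shift[of z k] z4 zw by (metis dvd_trans even_numeral)
    qed
    have ev: "\<exists>m. f (q * m) = f z" if "even z" "f z \<noteq> f w" for z
    proof (cases "4 dvd z")
      case False
      \<comment> \<open>Reflection in the odd number \<open>w\<close> sends numbers congruent to 2
        modulo 4 to multiples of 4.\<close>
      have "4 dvd 2 * (int 1 * w) - z" using False \<open>even z\<close> w by (simp, presburger)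
      moreover have "f (2 * (int 1 * w) - z) = f z" using that by (intro reflect) auto
      ultimately show ?thesis using four that by metis
    qed (use four that in blast)
    have cover: "\<exists>m. f (q * m) = f z" if zw: "f z \<noteq> f w" for z
    proof (cases "even z")
      case False
      \<comment> \<open>For a suitable \<open>k\<close> the midpoint \<open>y\<close> of
        \<open>z\<close> and \<open>k * w\<close> is even. Neither \<open>y\<close> nor
        \<open>z\<close> has the color \<open>f w\<close> of \<open>k * w\<close>, so their colors
        agree.\<close>
      have "4 dvd z + int 1 * w \<or> 4 dvd z + int 3 * w" using False w by (simp, presburger)
      then obtain k :: nat where k: "odd k" "4 dvd z + int k * w" by (metis odd_numeral odd_one)
      then obtain y where y: "z + int k * w = 2 * y" "even y"
        by (elim dvdE) (metis dvd_triv_left mult.assoc mult_2 numeral_Bit0 numeral_code(2))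
      have "f z = f y \<or> f y = f (int k * w) \<or> f z = f (int k * w)"
        using y(1) by (rule rainbow_freeD[OF rf])
      then have "f y = f z" using mult[of k] k(1) zw f_even[OF y(2)] by auto
      then show ?thesis using ev[OF y(2)] zw by metis
    qed (use ev zw in blast)
    have "range c \<subseteq> insert (f w) (range (\<lambda>m. c (x0 + q * m)))"
    proof
      fix a assume "a \<in> range c"
      then obtain x where "a = c x" by blast
      then have a: "a = f (x - x0)" by (simp add: f_def)
      show "a \<in> insert (f w) (range (\<lambda>m. c (x0 + q * m)))"
      proof (cases "a = f w")
        case False
        then obtain m where "f (q * m) = a" using cover[of "x - x0"] a by auto
        then show ?thesis unfolding f_def by blast
      qed simp
    qed
    moreover have perq: "periodic (int s) (\<lambda>m. c (x0 + q * m))"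
      using c(1) n2 by (intro periodic_affine) (metis of_nat_mult of_nat_numeral of_nat_power q_def)
    ultimately have "card (range c) \<le> card (insert (f w) (range (\<lambda>m. c (x0 + q * m))))"
      using finite_range_periodic[OF perq pos(1)] by (intro card_mono) auto
    also have "\<dots> \<le> Suc (card (range (\<lambda>m. c (x0 + q * m))))" by (rule card_insert_le_m1) auto
    also have "\<dots> \<le> max_colors s + 1"
      using card_range_le_max_colors[OF perq rainbow_free_affine[OF c(2)] pos(1)] by simp
    finally show ?thesis unfolding n2 using c(3) by simp
  qed
qed

text \<open>By \<open>zero\<close>, a progression with exactly one multiple of \<open>p\<close> has
  two equal colors under \<open>c0\<close> at its other terms. Since \<open>p\<close> is odd, two
  multiples force the third. By \<open>three\<close>, only two colors remain for progressions
  without multiples of \<open>p\<close>.\<close>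

lemma max_colors_mult_ge:
  fixes c0 :: "int \<Rightarrow> 'a"
  assumes "odd p" "m > 0" "periodic (int p) c0" "rainbow_free c0"
    and zero: "\<And>x. c0 x = c0 0 \<longleftrightarrow> int p dvd x"
    and three: "card (range c0) \<le> 3"
  shows "max_colors m + card (range c0) \<le> max_colors (p * m) + 1"
proof -
  have p: "p > 0" using \<open>odd p\<close> by (rule odd_pos)
  obtain c1 :: "int \<Rightarrow> nat" where c1: "periodic (int m) c1" "rainbow_free c1"
    "card (range c1) = max_colors m"
    using obtain_max_coloring[OF assms(2)] by blast
  have fin0: "finite (range c0)" and fin1: "finite (range c1)"
    using finite_range_periodic assms(2,3) c1(1) p by blast+
  \<comment> \<open>The sum type keeps the colors on the multiples of \<open>p\<close> apart from
    all others, so that the two color counts add up.\<close>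
  define c where "c x = (if int p dvd x then Inl (c1 (x div int p)) else Inr (c0 x))" for x
  have "periodic (int (p * m)) c"
  proof (rule periodicI)
    fix x y assume xy: "[x = y] (mod int (p * m))"
    then have xyp: "[x = y] (mod int p)" by (simp add: cong_modulus_mult)
    then have "c0 x = c0 y" "int p dvd x \<longleftrightarrow> int p dvd y"
      using assms(3) periodicD by (blast, simp add: cong_dvd_iff)
    moreover have "c1 (x div int p) = c1 (y div int p)" if "int p dvd x" "int p dvd y"
    proof -
      obtain u v where "x = int p * u" "y = int p * v"
        using \<open>int p dvd x\<close> \<open>int p dvd y\<close> by blast
      moreover then have "[u = v] (mod int m)" using xy p by (simp add: cong_def)
      ultimately show ?thesis using periodicD[OF c1(1)] p by simp
    qed
    ultimately show "c x = c y" by (simp add: c_def)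
  qed
  moreover have "rainbow_free c"
    unfolding rainbow_free_def
  proof (intro allI)
    fix x y :: int
    define z where "z = 2 * y - x"
    have xyz: "x + z = 2 * y" by (simp add: z_def)
    have two: "int p dvd 2 * y \<longleftrightarrow> int p dvd y"
      using \<open>odd p\<close> by (intro coprime_dvd_mult_right_iff) auto
    have c0: "c0 x = c0 y \<or> c0 y = c0 z \<or> c0 x = c0 z" using rainbow_freeD[OF assms(4) xyz] .
    have "c x = c y \<or> c y = c z \<or> c x = c z"
    proof (cases "int p dvd x")
      case x: True
      show ?thesis
      proof (cases "int p dvd y")
        case y: True
        then have z: "int p dvd z" using x by (simp add: z_def)
        obtain u v t where uv: "x = int p * u" "y = int p * v" "z = int p * t" using x y z by blast
        then have "int p * (u + t) = int p * (2 * v)" using xyz by (simp add: algebra_simps)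
        then have "u + t = 2 * v" using p by simp
        then show ?thesis using rainbow_freeD[OF c1(2)] uv p by (auto simp: c_def)
      next
        case y: False
        then have "\<not> int p dvd z" using x xyz two by (metis dvd_add_right_iff)
        then have "c0 y = c0 z" using c0 x y zero by metis
        then show ?thesis using y \<open>\<not> int p dvd z\<close> by (simp add: c_def)
      qed
    next
      case x: False
      show ?thesis
      proof (cases "int p dvd y")
        case y: True
        then have z: "\<not> int p dvd z" using x xyz two by (metis dvd_add_left_iff)
        then have "c0 x = c0 z" using c0 x y zero by metis
        then show ?thesis using x z by (simp add: c_def)
      next
        case y: False
        show ?thesis
        proof (cases "int p dvd z")
          case z: True
          then have "c0 x = c0 y" using c0 x y zero by metis
          then show ?thesis using x y by (simp add: c_def)
        next
          case z: False
          have "c0 0 \<notin> {c0 x, c0 y, c0 z}" using zero x y z by (metis insert_iff empty_iff)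
          moreover have "insert (c0 0) {c0 x, c0 y, c0 z} \<subseteq> range c0" by blast
          then have "card (insert (c0 0) {c0 x, c0 y, c0 z}) \<le> 3"
            using card_mono[OF fin0] three le_trans by blast
          ultimately have "card {c0 x, c0 y, c0 z} \<le> 2" by simp
          then have "c0 x = c0 y \<or> c0 y = c0 z \<or> c0 x = c0 z"
            by (auto simp: card_insert_if split: if_splits)
          then show ?thesis using x y z by (auto simp: c_def)
        qed
      qed
    qed
    then show "c x = c y \<or> c y = c (2 * y - x) \<or> c x = c (2 * y - x)" by (simp add: z_def)
  qed
  ultimately have "card (range c) \<le> max_colors (p * m)"
    using p assms(2) by (intro card_range_le_max_colors) auto
  moreover have range_c: "range c = Inl ` range c1 \<union> Inr ` (range c0 - {c0 0})"
  proof
    show "range c \<subseteq> Inl ` range c1 \<union> Inr ` (range c0 - {c0 0})"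
    proof
      fix a assume "a \<in> range c"
      then obtain x where "a = c x" by blast
      then show "a \<in> Inl ` range c1 \<union> Inr ` (range c0 - {c0 0})"
        using zero[of x] by (cases "int p dvd x") (simp_all add: c_def)
    qed
    show "Inl ` range c1 \<union> Inr ` (range c0 - {c0 0}) \<subseteq> range c"
    proof -
      have "Inl (c1 x) = c (int p * x)" for x using p by (simp add: c_def)
      moreover have "Inr (c0 x) = c x" if "c0 x \<noteq> c0 0" for x using that zero[of x] by (simp add: c_def)
      ultimately show ?thesis by auto
    qed
  qed
  moreover have "card (range c) = card (range c1) + (card (range c0) - 1)"
    unfolding range_c using fin0 fin1 by (subst card_Un_disjoint) (auto simp: card_image)
  moreover have "card (range c0) \<ge> 1" using fin0 by (simp add: Suc_leI card_gt_0_iff)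
  ultimately show ?thesis using c1(3) by linarith
qed

section \<open>Adjacent colors\<close>

text \<open>The position \<open>M + 1\<close> (\<open>M\<close> odd) or \<open>M + 2\<close> (\<open>M\<close> even) is forced to have color \<open>A\<close> by the
  progressions through \<open>0\<close> and \<open>M\<close>, but also to have color \<open>B\<close> or \<open>C\<close> by a progression inside
  the last \<open>2 * v\<close> positions of the interval.\<close>

lemma no_two_sided_interval_aux:
  fixes g :: "int \<Rightarrow> 'a"
  assumes rf: "rainbow_free g" and dist: "A \<noteq> B" "B \<noteq> C" "A \<noteq> C"
    and g0: "g 0 = A" and gM: "g M = A"
    and inner: "\<And>i. 0 < i \<Longrightarrow> i < M \<Longrightarrow> g i = B \<or> g i = C"
    and g1: "g 1 = B" and gM1: "g (M - 1) = C"
    and v: "0 < v" "v < M" "g (M - v) = B" "\<And>i. 0 < i \<Longrightarrow> i < v \<Longrightarrow> g (M - i) = C"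
    and side: "odd M \<or> 2 * v < M"
  shows False
proof -
  \<comment> \<open>Both \<open>i\<close> and \<open>2 * i\<close> avoid the color \<open>A\<close>
    of 0, so the progression from 0 forces equal colors.\<close>
  have double: "g (2 * i) = g i" if "0 < i" "2 * i < M" for i
    using rainbow_freeD[OF rf, of 0 "2 * i" i] inner[of i] inner[of "2 * i"] g0 dist that by auto
  have double': "g (M - 2 * i) = g (M - i)" if "0 < i" "2 * i < M" for i
    using rainbow_freeD[OF rf, of M "M - 2 * i" "M - i"] inner[of "M - i"] inner[of "M - 2 * i"]
      gM dist that by auto
  \<comment> \<open>For even \<open>v\<close> the midpoint of \<open>M\<close> and
    \<open>M - v\<close> has color \<open>C\<close> by the choice of \<open>v\<close>, which gives a
    rainbow progression.\<close>
  have "odd v"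
  proof
    assume "even v"
    then obtain u where "v = 2 * u" by (elim evenE)
    then show False using rainbow_freeD[OF rf, of M "M - v" "M - u"] v(1,3) v(4)[of u] gM dist by auto
  qed
  moreover have "v \<noteq> 1" using v(3) gM1 dist by auto
  ultimately obtain u where u: "v = 2 * u + 1" "u \<ge> 1"
    using v(1) by (elim oddE) auto
  have bc: "g (2 * y - x) = B \<or> g (2 * y - x) = C" if "g x = B" "g y = C" for x y
    using rainbow_freeD[OF rf, of x "2 * y - x" y] that dist by auto
  show False
  proof (cases "odd M")
    case True
    then obtain m where m: "M = 2 * m + 1" by (elim oddE)
    have m1: "m \<ge> 1" using m v u by auto
    have "g (m + 1) = g 1" using double'[of m] m m1 by simp
    then have "g (M + 1) = A \<or> g (M + 1) = B"
      using rainbow_freeD[OF rf, of 0 "M + 1" "m + 1"] m g0 g1 dist by auto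
    moreover have "g (M + 1) = A \<or> g (M + 1) = C"
      using rainbow_freeD[OF rf, of "M - 1" "M + 1" M] gM gM1 dist by auto
    ultimately have "g (M + 1) = A" using dist by auto
    \<comment> \<open>\<open>M + 1\<close> is the reflection of a position of color \<open>B\<close>
      in one of color \<open>C\<close>, so \<open>bc\<close> excludes the color
      \<open>A\<close>.\<close>
    moreover have "2 * (M - u) - (M - v) = M + 1" using u by simp
    ultimately show False using bc[of "M - v" "M - u"] v(3) v(4)[of u] u dist by auto
  next
    case False
    then obtain m where m: "M = 2 * m" by auto
    have v2: "2 * v < M" using False side by simp
    have m1: "m > v" using m v2 by auto
    have "g (m + 1) = g 2" using double'[of "m - 1"] m m1 v(1) by (simp add: algebra_simps)
    then have "g (m + 1) = B" using double[of 1] g1 m m1 u by auto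
    then have "g (M + 2) = A \<or> g (M + 2) = B"
      using rainbow_freeD[OF rf, of 0 "M + 2" "m + 1"] m g0 dist by auto
    moreover have "g (M - 2) = C" using double'[of 1] gM1 m m1 u by auto
    then have "g (M + 2) = A \<or> g (M + 2) = C"
      using rainbow_freeD[OF rf, of "M - 2" "M + 2" M] gM dist by auto
    ultimately have "g (M + 2) = A" using dist by auto
    moreover have "g (M - 2 * v) = B" using double'[of v] v v2 by simp
    moreover have "g (M - (v - 1)) = C" using v(4)[of "v - 1"] u by auto
    moreover have "2 * (M - (v - 1)) - (M - 2 * v) = M + 2" by simp
    ultimately show False using bc[of "M - 2 * v" "M - (v - 1)"] dist by auto
  qed
qed

lemma obtain_first:
  fixes P :: "int \<Rightarrow> bool"
  assumes "P a" "0 < a"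
  obtains v where "0 < v" "v \<le> a" "P v" "\<And>i. 0 < i \<Longrightarrow> i < v \<Longrightarrow> \<not> P i"
proof -
  define k where "k = (LEAST k::nat. P (int k) \<and> k > 0)"
  have ex: "P (int (nat a)) \<and> nat a > 0" using assms by simp
  have k: "P (int k) \<and> k > 0" unfolding k_def by (rule LeastI) (rule ex)
  have "k \<le> nat a" unfolding k_def by (rule Least_le) (rule ex)
  moreover have "\<not> P i" if "0 < i" "i < int k" for i
    using not_less_Least[of "nat i" "\<lambda>k. P (int k) \<and> k > 0"] that unfolding k_def[symmetric] by simp
  ultimately show thesis using that[of "int k"] k assms by auto
qed

text \<open>Let \<open>u\<close> be the first position of \<open>C\<close> and \<open>M - v\<close>
  the last position of \<open>B\<close>. The previous lemma and its mirror image leave only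
  \<open>M = 2 * m\<close> with \<open>u\<close> and \<open>v\<close> at least \<open>m\<close>.
  Both are odd and they are not both \<open>m\<close>, so the initial run of \<open>B\<close>
  overlaps the final run of \<open>C\<close>.\<close>

lemma no_two_sided_interval:
  fixes g :: "int \<Rightarrow> 'a"
  assumes rf: "rainbow_free g" and dist: "A \<noteq> B" "B \<noteq> C" "A \<noteq> C"
    and g0: "g 0 = A" and gM: "g M = A" and M: "M > 0"
    and inner: "\<And>i. 0 < i \<Longrightarrow> i < M \<Longrightarrow> g i = B \<or> g i = C"
    and g1: "g 1 = B" and gM1: "g (M - 1) = C"
  shows False
proof -
  define h where "h i = g (M - i)" for i
  have h_rf: "rainbow_free h"
    using rainbow_free_affine[OF rf, of M "-1"] by (simp add: h_def[abs_def])
  have M3: "M > 2" using M g1 gM1 gM g0 dist by (smt (verit))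
  obtain v where v: "0 < v" "v \<le> M - 1" "h v = B" "\<And>i. 0 < i \<Longrightarrow> i < v \<Longrightarrow> h i \<noteq> B"
    using obtain_first[of "\<lambda>i. h i = B" "M - 1"] M3 g1 by (auto simp: h_def)
  obtain u where u: "0 < u" "u \<le> M - 1" "g u = C" "\<And>i. 0 < i \<Longrightarrow> i < u \<Longrightarrow> g i \<noteq> C"
    using obtain_first[of "\<lambda>i. g i = C" "M - 1"] M3 gM1 by auto
  have vC: "g (M - i) = C" if "0 < i" "i < v" for i
    using inner[of "M - i"] v(2) v(4)[of i] that by (auto simp: h_def)
  have uB: "g i = B" if "0 < i" "i < u" for i
    using inner[of i] u(2) u(4)[of i] that by auto
  have 1: "\<not> (odd M \<or> 2 * v < M)"
    using no_two_sided_interval_aux[OF rf dist g0 gM inner g1 gM1 v(1) _ _ vC] v by (auto simp: h_def)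
  have 2: "\<not> (odd M \<or> 2 * u < M)"
  proof
    assume "odd M \<or> 2 * u < M"
    moreover have "h i = C \<or> h i = B" if "0 < i" "i < M" for i
      using inner[of "M - i"] that by (auto simp: h_def)
    ultimately show False
      using no_two_sided_interval_aux[OF h_rf dist(3) dist(2)[symmetric] dist(1), of M u]
        g0 gM g1 gM1 u uB by (auto simp: h_def)
  qed
  obtain m where m: "M = 2 * m" using 1 by (auto elim: evenE)
  have "m \<le> v" "m \<le> u" using 1 2 m by auto
  have "u \<noteq> 1" "v \<noteq> 1" using u(3) v(3) g1 gM1 dist by (auto simp: h_def)
  have "odd u"
  proof
    assume "even u"
    then obtain w where "u = 2 * w" by (elim evenE)
    then show False using rainbow_freeD[OF rf, of 0 u w] u(1,3) uB[of w] g0 dist by auto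
  qed
  have "odd v"
  proof
    assume "even v"
    then obtain w where "v = 2 * w" by (elim evenE)
    then show False using rainbow_freeD[OF rf, of M "M - v" "M - w"] v(1,3) vC[of w] gM dist
      by (auto simp: h_def)
  qed
  have "\<not> (m < v \<and> m < u)" using vC[of m] uB[of m] m M dist by auto
  then consider "m = u" | "m = v" using \<open>m \<le> v\<close> \<open>m \<le> u\<close> by linarith
  then show False
  proof cases
    case 1
    have "v \<noteq> m" using 1 m u(3) v(3) dist by (auto simp: h_def)
    moreover have "v \<noteq> m + 1" using 1 \<open>odd u\<close> \<open>odd v\<close> by auto
    ultimately have "m + 1 < v" using \<open>m \<le> v\<close> by linarith
    then show ?thesis using vC[of "m + 1"] uB[of "m - 1"] 1 \<open>u \<noteq> 1\<close> u(1) m dist by auto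
  next
    case 2
    have "u \<noteq> m" using 2 m u(3) v(3) dist by (auto simp: h_def)
    moreover have "u \<noteq> m + 1" using 2 \<open>odd u\<close> \<open>odd v\<close> by auto
    ultimately have "m + 1 < u" using \<open>m \<le> u\<close> by linarith
    then show ?thesis using vC[of "m - 1"] uB[of "m + 1"] 2 \<open>v \<noteq> 1\<close> v(1) m dist by auto
  qed
qed

text \<open>Comparing unordered pairs makes the relation symmetric in the two colors.\<close>

definition adjacent :: "(int \<Rightarrow> 'a) \<Rightarrow> int \<Rightarrow> 'a \<Rightarrow> 'a \<Rightarrow> bool" where
  "adjacent g d X Y \<longleftrightarrow> (\<exists>x. {g x, g (x + d)} = {X, Y})"

text \<open>Color \<open>a\<close> occurs everywhere or nowhere from \<open>l + 1\<close> to
  \<open>r\<close>, and the change between \<open>b\<close> and \<open>c\<close> at \<open>j\<close>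
  leaves only the latter. So \<open>a\<close> stands at \<open>l\<close> and \<open>r + 1\<close>,
  next to \<open>b\<close> and \<open>c\<close> respectively, as in
  \<open>no_two_sided_interval\<close>.\<close>

lemma no_tight_interval:
  fixes g :: "int \<Rightarrow> 'a"
  assumes rf: "rainbow_free g" and dist: "a \<noteq> b" "b \<noteq> c" "a \<noteq> c"
    and rng: "range g \<subseteq> {a, b, c}"
    and left: "{g l, g (l + 1)} = {a, b}" and right: "{g r, g (r + 1)} = {a, c}"
    and inner: "\<And>i. l < i \<Longrightarrow> i < r \<Longrightarrow> {g i, g (i + 1)} \<noteq> {a, b} \<and> {g i, g (i + 1)} \<noteq> {a, c}"
    and j: "l < j" "j < r" "{g j, g (j + 1)} = {b, c}"
  shows False
proof -
  have col: "g i = a \<or> g i = b \<or> g i = c" for i using rng by blast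
  have step: "g (i + 1) = a \<longleftrightarrow> g i = a" if "l < i" "i < r" for i
    using inner[OF that] col[of i] col[of "i + 1"] by auto
  have const: "g (l + 1 + int k) = a \<longleftrightarrow> g (l + 1) = a" if "l + 1 + int k \<le> r" for k
    using that
  proof (induction k)
    case (Suc k)
    then show ?case using step[of "l + 1 + int k"] by (simp add: algebra_simps)
  qed simp
  have const': "g i = a \<longleftrightarrow> g (l + 1) = a" if "l < i" "i \<le> r" for i
    using const[of "nat (i - l - 1)"] that by simp
  have ga: "g (l + 1) \<noteq> a"
    using const'[of j] j dist by (auto simp: doubleton_eq_iff)
  define f where "f i = g (l + i)" for i
  have f_rf: "rainbow_free f"
    using rainbow_free_affine[OF rf, of l 1] by (simp add: f_def[abs_def])
  have "g r \<noteq> a" using const'[of r] ga j by auto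
  then have ends: "f 0 = a" "f 1 = b" "f (r + 1 - l) = a" "f (r + 1 - l - 1) = c"
    using left right ga by (auto simp: f_def doubleton_eq_iff algebra_simps)
  have "f i = b \<or> f i = c" if "0 < i" "i < r + 1 - l" for i
    using const'[of "l + i"] that ga col[of "l + i"] by (auto simp: f_def)
  then show False
    using no_two_sided_interval[OF f_rf dist, of "r + 1 - l"] ends j by auto
qed

text \<open>In a shortest interval containing all three kinds of color changes, the first and the last
  change occur only once, which is the situation of the previous lemma.\<close>

lemma not_all_adjacent_1:
  fixes g :: "int \<Rightarrow> 'a"
  assumes rf: "rainbow_free g" and dist: "A \<noteq> B" "B \<noteq> C" "A \<noteq> C"
    and rng: "range g \<subseteq> {A, B, C}"
    and adj: "adjacent g 1 A B" "adjacent g 1 B C" "adjacent g 1 A C"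
  shows False
proof -
  define T where "T i = {g i, g (i + 1)}" for i
  define S where "S = {{A, B}, {B, C}, {A, C}}"
  define Q where "Q L \<longleftrightarrow> (\<exists>l. \<forall>X\<in>S. \<exists>i. l \<le> i \<and> i \<le> l + int L \<and> T i = X)" for L :: nat
  obtain i1 i2 i3 where i: "T i1 = {A, B}" "T i2 = {B, C}" "T i3 = {A, C}"
    using adj unfolding adjacent_def T_def by blast
  define l0 where "l0 = min i1 (min i2 i3)"
  define L0 where "L0 = nat (max i1 (max i2 i3) - l0)"
  have "l0 \<le> i1 \<and> i1 \<le> l0 + int L0" "l0 \<le> i2 \<and> i2 \<le> l0 + int L0"
    "l0 \<le> i3 \<and> i3 \<le> l0 + int L0"
    unfolding L0_def l0_def by auto
  then have "\<forall>X\<in>S. \<exists>i. l0 \<le> i \<and> i \<le> l0 + int L0 \<and> T i = X"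
    unfolding S_def using i by blast
  then have "Q L0" unfolding Q_def by (rule exI)
  define L where "L = (LEAST L. Q L)"
  have "Q L" unfolding L_def by (rule LeastI) fact
  then obtain l where l: "\<forall>X\<in>S. \<exists>i. l \<le> i \<and> i \<le> l + int L \<and> T i = X"
    unfolding Q_def by blast
  have "L \<noteq> 0"
  proof
    assume "L = 0"
    then have "T l = {A, B}" "T l = {B, C}" using l unfolding S_def by fastforce+
    then show False using dist by (auto simp: doubleton_eq_iff)
  qed
  then have "L - 1 < (LEAST L. Q L)" unfolding L_def[symmetric] by simp
  then have "\<not> Q (L - 1)" by (rule not_less_Least)
  then have "\<not> (\<forall>X\<in>S. \<exists>i. m \<le> i \<and> i \<le> m + int (L - 1) \<and> T i = X)" for m
    unfolding Q_def by (meson exI)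
  then have min: "\<exists>X\<in>S. \<forall>i. m \<le> i \<and> i \<le> m + int (L - 1) \<longrightarrow> T i \<noteq> X" for m by meson
  define r where "r = l + int L"
  have lr: "l < r" using \<open>L \<noteq> 0\<close> by (simp add: r_def)
  \<comment> \<open>Dropping the left end of the shortest window loses some kind \<open>X\<close> of
    change, which therefore occurs in the window at \<open>l\<close> only. Symmetrically,
    \<open>Y\<close> occurs only at \<open>r\<close>.\<close>
  obtain X where X: "X \<in> S" "\<And>i. l + 1 \<le> i \<Longrightarrow> i \<le> r \<Longrightarrow> T i \<noteq> X"
  proof -
    have "l + 1 + int (L - 1) = r" using \<open>L \<noteq> 0\<close> by (simp add: r_def of_nat_diff)
    then show thesis using min[of "l + 1"] that by auto
  qed
  obtain Y where Y: "Y \<in> S" "\<And>i. l \<le> i \<Longrightarrow> i \<le> r - 1 \<Longrightarrow> T i \<noteq> Y"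
  proof -
    have "l + int (L - 1) = r - 1" using \<open>L \<noteq> 0\<close> by (simp add: r_def of_nat_diff)
    then show thesis using min[of l] that by auto
  qed
  have all: "\<exists>i. l \<le> i \<and> i \<le> r \<and> T i = Z" if "Z \<in> S" for Z
    using l that unfolding r_def by blast
  have Tl: "T l = X"
  proof -
    obtain i where i: "l \<le> i" "i \<le> r" "T i = X" using all[OF X(1)] by blast
    then have "i = l" using X(2)[of i] by fastforce
    then show ?thesis using i by simp
  qed
  have Tr: "T r = Y"
  proof -
    obtain i where i: "l \<le> i" "i \<le> r" "T i = Y" using all[OF Y(1)] by blast
    then have "i = r" using Y(2)[of i] by fastforce
    then show ?thesis using i by simp
  qed
  have XY: "X \<noteq> Y" using X(2)[of r] Tr lr by auto
  \<comment> \<open>The color common to \<open>X\<close> and \<open>Y\<close> is called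
    \<open>a\<close>; the cases at the end are the six ways of naming.\<close>
  have main: False if dist: "a \<noteq> b" "b \<noteq> c" "a \<noteq> c"
    and abc: "{a, b, c} = {A, B, C}" "X = {a, b}" "Y = {a, c}" "{b, c} \<in> S" for a b c
  proof -
    obtain j where j: "l \<le> j" "j \<le> r" "T j = {b, c}" using all[OF abc(4)] by blast
    have "{b, c} \<noteq> X" "{b, c} \<noteq> Y" using abc dist by (auto simp: doubleton_eq_iff)
    then have "j \<noteq> l" "j \<noteq> r" using Tl Tr j by auto
    then have j': "l < j" "j < r" using j by simp_all
    show False
    proof (rule no_tight_interval[OF rf dist, of l r j])
      show "range g \<subseteq> {a, b, c}" using rng abc(1) by simp
      show "{g l, g (l + 1)} = {a, b}" "{g r, g (r + 1)} = {a, c}" "{g j, g (j + 1)} = {b, c}"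
        using Tl Tr abc(2,3) j(3) by (simp_all add: T_def)
      show "{g i, g (i + 1)} \<noteq> {a, b} \<and> {g i, g (i + 1)} \<noteq> {a, c}" if "l < i" "i < r" for i
        using X(2)[of i] Y(2)[of i] that abc(2,3) by (simp add: T_def)
    qed (use j' in simp_all)
  qed
  have "X = {A, B} \<or> X = {B, C} \<or> X = {A, C}" "Y = {A, B} \<or> Y = {B, C} \<or> Y = {A, C}"
    using X(1) Y(1) by (simp_all add: S_def)
  then consider "X = {A, B}" "Y = {A, C}" | "X = {A, B}" "Y = {B, C}" | "X = {B, C}" "Y = {A, B}"
    | "X = {B, C}" "Y = {A, C}" | "X = {A, C}" "Y = {A, B}" | "X = {A, C}" "Y = {B, C}"
    using XY by metis
  then show False
  proof cases
    case 1 show ?thesis by (rule main[of A B C]) (use 1 dist in \<open>simp_all add: S_def insert_commute\<close>)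
  next
    case 2 show ?thesis by (rule main[of B A C]) (use 2 dist in \<open>simp_all add: S_def insert_commute\<close>)
  next
    case 3 show ?thesis by (rule main[of B C A]) (use 3 dist in \<open>simp_all add: S_def insert_commute\<close>)
  next
    case 4 show ?thesis by (rule main[of C B A]) (use 4 dist in \<open>simp_all add: S_def insert_commute\<close>)
  next
    case 5 show ?thesis by (rule main[of A C B]) (use 5 dist in \<open>simp_all add: S_def insert_commute\<close>)
  next
    case 6 show ?thesis by (rule main[of C A B]) (use 6 dist in \<open>simp_all add: S_def insert_commute\<close>)
  qed
qed

section \<open>Scaling and doubling of differences modulo a prime\<close>

lemma adjacent_commute: "adjacent c d X Y \<longleftrightarrow> adjacent c d Y X"
  by (simp add: adjacent_def insert_commute)

lemma adjacentI: "c x = X \<Longrightarrow> c (x + d) = Y \<Longrightarrow> adjacent c d X Y"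
  unfolding adjacent_def by blast

lemma adjacent_uminus: "adjacent c (- d) X Y \<longleftrightarrow> adjacent c d X Y"
proof -
  have "adjacent c e X Y" if "adjacent c (- e) X Y" for e
  proof -
    from that obtain x where "{c x, c (x - e)} = {X, Y}" by (auto simp: adjacent_def)
    then have "{c (x - e), c (x - e + e)} = {X, Y}" by (simp add: insert_commute)
    then show ?thesis unfolding adjacent_def by blast
  qed
  from this[of d] this[of "- d"] show ?thesis by auto
qed

lemma adjacent_cong:
  assumes "periodic n c" "[d = e] (mod n)"
  shows "adjacent c d X Y \<longleftrightarrow> adjacent c e X Y"
proof -
  have "c (x + d) = c (x + e)" for x
    using assms(2) by (intro periodicD[OF assms(1)] cong_add cong_refl)
  then show ?thesis by (simp add: adjacent_def)
qed

lemma prime_cong_solve: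
  assumes "prime p" "\<not> int p dvd d"
  obtains i where "[d * i = x] (mod int p)"
proof -
  have "coprime d (int p)"
    using assms by (metis coprime_commute prime_imp_coprime prime_nat_int_transfer)
  then obtain j where "[d * j = 1] (mod int p)" using cong_solve_coprime_int by blast
  then have "[d * j * x = 1 * x] (mod int p)" by (rule cong_mult[OF _ cong_refl])
  then show thesis using that[of "j * x"] by (simp add: mult.assoc)
qed

text \<open>Multiplication by \<open>d\<close> permutes Z_p, so facts about difference 1 carry over
  to all differences prime to \<open>p\<close>. The form \<open>0 + d * i\<close> matches
  \<open>rainbow_free_affine\<close>.\<close>

lemma adjacent_multiples:
  assumes "prime p" "\<not> int p dvd d" "periodic (int p) c"
  shows "adjacent (\<lambda>i. c (0 + d * i)) k X Y \<longleftrightarrow> adjacent c (d * k) X Y"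
proof
  assume "adjacent (\<lambda>i. c (0 + d * i)) k X Y"
  then obtain i where "{c (d * i), c (d * i + d * k)} = {X, Y}"
    by (auto simp: adjacent_def algebra_simps)
  then show "adjacent c (d * k) X Y" unfolding adjacent_def by blast
next
  assume "adjacent c (d * k) X Y"
  then obtain x where x: "{c x, c (x + d * k)} = {X, Y}" by (auto simp: adjacent_def)
  obtain i where i: "[d * i = x] (mod int p)" using prime_cong_solve[OF assms(1,2)] by blast
  then have "c (d * i) = c x" "c (d * i + d * k) = c (x + d * k)"
    using cong_add[OF i cong_refl] by (auto intro: periodicD[OF assms(3)])
  then have "{c (d * i), c (d * i + d * k)} = {X, Y}" using x by simp
  then show "adjacent (\<lambda>i. c (0 + d * i)) k X Y"
    unfolding adjacent_def by (intro exI[of _ i]) (simp add: algebra_simps)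
qed

lemma range_multiples:
  assumes "prime p" "\<not> int p dvd d" "periodic (int p) c"
  shows "range (\<lambda>i. c (0 + d * i)) = range c"
proof (intro equalityI subsetI)
  fix a assume "a \<in> range c"
  then obtain x where x: "a = c x" by blast
  obtain i where "[d * i = x] (mod int p)" using prime_cong_solve[OF assms(1,2)] by blast
  then have "a = c (0 + d * i)" using periodicD[OF assms(3)] x by simp
  then show "a \<in> range (\<lambda>i. c (0 + d * i))" by blast
qed auto

lemma not_adjacent_multiple:
  assumes "periodic n c" "n dvd d" "X \<noteq> Y"
  shows "\<not> adjacent c d X Y"
proof -
  have "c (x + d) = c x" for x
    using assms(2) by (intro periodicD[OF assms(1)]) (simp add: cong_iff_dvd_diff)
  then show ?thesis using assms(3) by (auto simp: adjacent_def)
qed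

lemma not_all_adjacent:
  assumes "prime p" "periodic (int p) c" "rainbow_free c"
    and dist: "A \<noteq> B" "B \<noteq> C" "A \<noteq> C" and "range c = {A, B, C}"
  shows "\<not> (adjacent c d A B \<and> adjacent c d B C \<and> adjacent c d A C)"
proof (cases "int p dvd d")
  case True
  then show ?thesis using not_adjacent_multiple[OF assms(2)] dist(1) by blast
next
  case False
  note adj = adjacent_multiples[OF assms(1) False assms(2), of 1]
  show ?thesis
    using not_all_adjacent_1[OF rainbow_free_affine[OF assms(3)] dist, of 0 d]
      range_multiples[OF assms(1) False assms(2)] assms(7) adj by auto
qed

text \<open>Take an \<open>A\<close> and a later \<open>C\<close> with only \<open>B\<close> between
  them. A gap of 1 would make them adjacent at 1 and a gap of 2 would be rainbow, so the positions
  two steps inside from either end have color \<open>B\<close>.\<close>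

lemma adjacent_2_aux:
  assumes rf: "rainbow_free g" and dist: "A \<noteq> B" "B \<noteq> C" "A \<noteq> C" and rng: "range g \<subseteq> {A, B, C}"
    and nadj: "\<not> adjacent g 1 A C" and ij: "g i = A" "g j = C" "i < j"
  shows "adjacent g 2 A B \<and> adjacent g 2 B C"
proof -
  obtain v where v: "0 < v" "g (i + v) = C" "\<And>k. 0 < k \<Longrightarrow> k < v \<Longrightarrow> g (i + k) \<noteq> C"
    using obtain_first[of "\<lambda>k. g (i + k) = C" "j - i"] ij by auto
  define r where "r = i + v"
  obtain u where u: "0 < u" "u \<le> v" "g (r - u) = A" "\<And>k. 0 < k \<Longrightarrow> k < u \<Longrightarrow> g (r - k) \<noteq> A"
    using obtain_first[of "\<lambda>k. g (r - k) = A" v] v ij by (auto simp: r_def)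
  have B: "g (r - k) = B" if "0 < k" "k < u" for k
    using u(4)[of k] v(3)[of "v - k"] u(2) that rng by (auto simp: r_def algebra_simps)
  have "u \<noteq> 1" using adjacentI[of g "r - u" A 1 C] nadj u(3) v(2) by (auto simp: r_def)
  moreover have "u \<noteq> 2"
    using rainbow_freeD[OF rf, of "r - 2" r "r - 1"] B[of 1] u(3) v(2) dist by (auto simp: r_def)
  ultimately have "u \<ge> 3" using u(1) by auto
  then have "g (r - u + 2) = B" "g (r - 2) = B" using B[of "u - 2"] B[of 2] by (auto simp: algebra_simps)
  then show ?thesis using u(3) v(2) adjacentI[of g "r - u" A 2 B] adjacentI[of g "r - 2" B 2 C]
    by (auto simp: r_def)
qed

lemma adjacent_2:
  assumes "rainbow_free g" "A \<noteq> B" "B \<noteq> C" "A \<noteq> C" "range g = {A, B, C}" "\<not> adjacent g 1 A C"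
  shows "adjacent g 2 A B \<and> adjacent g 2 B C"
proof -
  have "A \<in> range g" "C \<in> range g" using assms(5) by auto
  then obtain i j where ij: "g i = A" "g j = C" by blast
  then have "i \<noteq> j" using assms(4) by auto
  then consider "i < j" | "j < i" by linarith
  then show ?thesis
  proof cases
    case 1
    then show ?thesis using adjacent_2_aux[OF assms(1-4) _ assms(6)] ij assms(5) by blast
  next
    case 2
    have "adjacent g 2 C B \<and> adjacent g 2 B A"
      by (rule adjacent_2_aux[OF assms(1), of C B A j i])
        (use 2 ij assms in \<open>auto simp: adjacent_commute[of g 1 C A]\<close>)
    then show ?thesis by (simp add: adjacent_commute)
  qed
qed

text \<open>After rescaling by \<open>d\<close>, \<open>adjacent_2\<close> makes the other two pairs
  adjacent at \<open>2 * d\<close>, and not all three pairs can be.\<close>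

lemma not_adjacent_double:
  assumes p: "prime p" and per: "periodic (int p) c" and rf: "rainbow_free c"
    and dist: "A \<noteq> B" "B \<noteq> C" "A \<noteq> C" and rng: "range c = {A, B, C}"
    and nadj: "\<not> adjacent c d A C"
  shows "\<not> adjacent c (2 * d) A C"
proof (cases "int p dvd d")
  case True
  then show ?thesis using not_adjacent_multiple[OF per] dist by (simp add: dvd_mult)
next
  case False
  note adj = adjacent_multiples[OF p False per]
  have "adjacent (\<lambda>i. c (0 + d * i)) 2 A B \<and> adjacent (\<lambda>i. c (0 + d * i)) 2 B C"
    by (rule adjacent_2[OF rainbow_free_affine[OF rf] dist])
      (use range_multiples[OF p False per] rng adj[of 1] nadj in auto)
  then have "adjacent c (2 * d) A B" "adjacent c (2 * d) B C" unfolding adj by (simp_all add: mult.commute)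
  then show ?thesis using not_all_adjacent[OF p per rf dist rng] by blast
qed

lemma not_adjacent_power2:
  assumes "prime p" "periodic (int p) c" "rainbow_free c"
    "A \<noteq> B" "B \<noteq> C" "A \<noteq> C" "range c = {A, B, C}" "\<not> adjacent c d A C"
  shows "\<not> adjacent c (2 ^ k * d) A C"
proof (induction k)
  case (Suc k)
  show ?case using not_adjacent_double[OF assms(1-7) Suc] by (simp add: mult.assoc)
qed (use assms in simp)

text \<open>By \<open>not_all_adjacent\<close> some pair is not adjacent at 1; the colors are named
  so that this pair is \<open>A\<close>, \<open>C\<close>.\<close>

lemma obtain_3_coloring:
  assumes "prime p" "max_colors p \<ge> 3"
  obtains c :: "int \<Rightarrow> nat" and A B C where "periodic (int p) c" "rainbow_free c"
    "A \<noteq> B" "B \<noteq> C" "A \<noteq> C" "range c = {A, B, C}" "\<not> adjacent c 1 A C"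
proof -
  have "p > 0" using assms(1) prime_gt_0_nat by blast
  then obtain c :: "int \<Rightarrow> nat" where c: "periodic (int p) c" "rainbow_free c" "range c = {1..3}"
    using obtain_coloring[of p 3] assms(2) by auto
  have "{1..3} = {1, 2, 3::nat}" by auto
  then have rng: "range c = {1, 2, 3}" using c(3) by simp
  have "\<not> (adjacent c 1 1 2 \<and> adjacent c 1 2 3 \<and> adjacent c 1 1 3)"
    by (rule not_all_adjacent[OF assms(1) c(1,2)]) (use rng in auto)
  then consider "\<not> adjacent c 1 1 2" | "\<not> adjacent c 1 2 3" | "\<not> adjacent c 1 1 3" by blast
  then show thesis
  proof cases
    case 1 then show ?thesis using that[of c 1 3 2] c rng by auto
  next
    case 2 then show ?thesis using that[of c 2 1 3] c rng by auto
  next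
    case 3 then show ?thesis using that[of c 1 2 3] c rng by auto
  qed
qed

text \<open>Non-adjacency at 1 spreads to all units, although a position of color \<open>A\<close>
  and one of color \<open>C\<close> differ by a unit.\<close>

lemma max_colors_prime_le_2:
  assumes p: "prime p"
    and gen: "\<And>y. \<not> int p dvd y \<Longrightarrow> \<exists>k. [y = 2 ^ k] (mod int p) \<or> [y = - (2 ^ k)] (mod int p)"
  shows "max_colors p \<le> 2"
proof (rule ccontr)
  assume "\<not> max_colors p \<le> 2"
  then obtain c :: "int \<Rightarrow> nat" and A B C where c: "periodic (int p) c" "rainbow_free c"
    "A \<noteq> B" "B \<noteq> C" "A \<noteq> C" "range c = {A, B, C}" "\<not> adjacent c 1 A C"
    using obtain_3_coloring[OF p] by (metis not_less_eq_eq numeral_2_eq_2 numeral_3_eq_3)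
  have "A \<in> range c" "C \<in> range c" using c(6) by auto
  then obtain x y where xy: "c x = A" "c y = C" by blast
  then have adj: "adjacent c (y - x) A C" by (intro adjacentI[of c x]) auto
  then have "\<not> int p dvd y - x" using not_adjacent_multiple[OF c(1)] c(5) by blast
  then obtain k where "[y - x = 2 ^ k] (mod int p) \<or> [y - x = - (2 ^ k)] (mod int p)"
    using gen by blast
  then have "adjacent c (2 ^ k * 1) A C"
    using adj adjacent_cong[OF c(1)] adjacent_uminus by (metis mult.right_neutral)
  then show False using not_adjacent_power2[OF p c] by blast
qed

text \<open>If \<open>n\<close> divides one of the three terms, the other two agree modulo
  \<open>n\<close> up to a factor -1 or 2 and so have the same color. Otherwise only two colors are
  available.\<close>

lemma rainbow_free_invariant:
  fixes c :: "int \<Rightarrow> 'a"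
  assumes per: "periodic n c" and double: "\<And>x. c (2 * x) = c x" and neg: "\<And>x. c (- x) = c x"
    and two: "\<And>x. \<not> n dvd x \<Longrightarrow> c x = a \<or> c x = b"
  shows "rainbow_free c"
  unfolding rainbow_free_def
proof (intro allI)
  fix x y :: int
  have shift: "c (u + v) = c u" if "n dvd v" for u v
    using that by (intro periodicD[OF per]) (simp add: cong_iff_dvd_diff)
  consider "n dvd x" | "n dvd y" | "n dvd 2 * y - x"
    | "\<not> n dvd x" "\<not> n dvd y" "\<not> n dvd 2 * y - x" by blast
  then show "c x = c y \<or> c y = c (2 * y - x) \<or> c x = c (2 * y - x)"
  proof cases
    case 1
    then have "c (2 * y + - x) = c (2 * y)" by (intro shift) simp
    then show ?thesis using double[of y] by simp
  next
    case 2
    then have "c (- x + 2 * y) = c (- x)" by (intro shift) simp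
    then show ?thesis using neg[of x] by simp
  next
    case 3
    then have "c (x + (2 * y - x)) = c x" by (rule shift)
    then show ?thesis using double[of y] by simp
  next
    case 4
    then show ?thesis using two by metis
  qed
qed

lemma obtain_singleton_3_coloring:
  assumes p: "prime p" "odd p" "max_colors p \<ge> 3"
  obtains c0 :: "int \<Rightarrow> nat" where "periodic (int p) c0" "rainbow_free c0"
    "\<And>x. c0 x = c0 0 \<longleftrightarrow> int p dvd x" "card (range c0) = 3"
proof -
  obtain c :: "int \<Rightarrow> nat" and A B C where c: "periodic (int p) c" "rainbow_free c"
    "A \<noteq> B" "B \<noteq> C" "A \<noteq> C" "range c = {A, B, C}" "\<not> adjacent c 1 A C"
    using obtain_3_coloring[OF p(1,3)] by blast
  define c0 :: "int \<Rightarrow> nat" where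
    "c0 x = (if int p dvd x then 0 else if adjacent c x A C then 2 else 1)" for x
  have double: "c0 (2 * x) = c0 x" for x
  proof -
    have "int p dvd 2 * x \<longleftrightarrow> int p dvd x"
      using p(2) by (intro coprime_dvd_mult_right_iff) auto
    moreover have "adjacent c x A C" if "adjacent c (2 * x) A C"
      using not_adjacent_double[OF p(1) c(1-6)] that by blast
    \<comment> \<open>By Fermat, \<open>p - 2\<close> further doublings lead from
      \<open>2 * x\<close> back to \<open>x\<close>, so non-adjacency would return to
      \<open>x\<close>.\<close>
    moreover have "adjacent c (2 * x) A C" if adj: "adjacent c x A C"
    proof (rule ccontr)
      assume "\<not> adjacent c (2 * x) A C"
      then have "\<not> adjacent c (2 ^ (p - 2) * (2 * x)) A C"
        by (rule not_adjacent_power2[OF p(1) c(1-6)])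
      moreover have p2: "p > 2" using p(1,2) by (metis even_numeral le_neq_implies_less prime_ge_2_nat)
      have "p - 1 = Suc (p - 2)" using p2 by simp
      then have "(2::int) ^ (p - 2) * (2 * x) = 2 ^ (p - 1) * x" by simp
      moreover have "[2 ^ (p - 1) = (1::int)] (mod int p)"
      proof -
        have "\<not> p dvd 2" using p2 dvd_imp_le by fastforce
        then have "[2 ^ (p - 1) = (1::nat)] (mod p)" using fermat_theorem[OF p(1)] by blast
        then have "[int (2 ^ (p - 1)) = int 1] (mod int p)" by (simp only: cong_int_iff)
        then show ?thesis by simp
      qed
      then have "[2 ^ (p - 1) * x = 1 * x] (mod int p)" by (rule cong_mult[OF _ cong_refl])
      ultimately show False using adjacent_cong[OF c(1)] adj by (metis mult_1)
    qed
    ultimately show ?thesis unfolding c0_def by auto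
  qed
  have neg: "c0 (- x) = c0 x" for x by (simp add: c0_def adjacent_uminus)
  have per: "periodic (int p) c0"
    by (rule periodicI) (simp add: c0_def adjacent_cong[OF c(1)] cong_dvd_iff)
  have zero: "c0 x = c0 0 \<longleftrightarrow> int p dvd x" for x by (simp add: c0_def)
  have "rainbow_free c0"
    by (rule rainbow_free_invariant[OF per double neg, of 1 2]) (simp add: c0_def)
  moreover have "range c0 = {0, 1, 2}"
  proof
    show "range c0 \<subseteq> {0, 1, 2}" by (auto simp: c0_def)
    have "A \<in> range c" "C \<in> range c" using c(6) by auto
    then obtain x y where xy: "c x = A" "c y = C" by blast
    then have adj: "adjacent c (y - x) A C" by (intro adjacentI[of c x]) auto
    then have "\<not> int p dvd y - x" using not_adjacent_multiple[OF c(1)] c(5) by blast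
    then have "c0 (y - x) = 2" using adj by (simp add: c0_def)
    moreover have "c0 1 = 1" using c(7) p(1) by (auto simp: c0_def)
    moreover have "c0 0 = 0" by (simp add: c0_def)
    ultimately show "{0, 1, 2} \<subseteq> range c0" by (metis empty_subsetI insert_subset rangeI)
  qed
  then have "card (range c0) = 3" by simp
  ultimately show thesis using that per zero by blast
qed

section \<open>Sumsets modulo a prime\<close>

definition sumset :: "int \<Rightarrow> int set \<Rightarrow> int set \<Rightarrow> int set" where
  "sumset p X Y = (\<lambda>(x, y). (x + y) mod p) ` (X \<times> Y)"

definition affine_image :: "int \<Rightarrow> int \<Rightarrow> int \<Rightarrow> int set \<Rightarrow> int set" where
  "affine_image p a t X = (\<lambda>x. (a * x + t) mod p) ` X"

lemma sumsetI: "x \<in> X \<Longrightarrow> y \<in> Y \<Longrightarrow> (x + y) mod p \<in> sumset p X Y"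
  unfolding sumset_def by force

lemma sumsetE:
  assumes "z \<in> sumset p X Y"
  obtains x y where "x \<in> X" "y \<in> Y" "z = (x + y) mod p"
  using assms unfolding sumset_def by auto

lemma sumset_mono: "X \<subseteq> X' \<Longrightarrow> Y \<subseteq> Y' \<Longrightarrow> sumset p X Y \<subseteq> sumset p X' Y'"
  unfolding sumset_def by blast

lemma sumset_subset: "p > 0 \<Longrightarrow> sumset p X Y \<subseteq> {0..<p}"
  unfolding sumset_def by auto

lemma finite_sumset: "p > 0 \<Longrightarrow> finite (sumset p X Y)"
  using finite_subset[OF sumset_subset finite_atLeastLessThan_int] .

lemma sumset_Un: "sumset p (X \<union> Y) U = sumset p X U \<union> sumset p Y U"
  unfolding sumset_def by blast

lemma affine_image_subset: "p > 0 \<Longrightarrow> affine_image p a t X \<subseteq> {0..<p}"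
  unfolding affine_image_def by auto

lemma inj_on_affine:
  fixes p :: int
  assumes "coprime a p"
  shows "inj_on (\<lambda>x. (a * x + t) mod p) {0..<p}"
proof (rule inj_onI)
  fix x y assume xy: "x \<in> {0..<p}" "y \<in> {0..<p}" "(a * x + t) mod p = (a * y + t) mod p"
  then have "[a * x + t = a * y + t] (mod p)" by (simp add: cong_def)
  then have "[a * x = a * y] (mod p)" by (simp add: cong_add_rcancel)
  then have "[x = y] (mod p)" using assms by (simp add: cong_mult_lcancel)
  then show "x = y" using xy by (simp add: cong_def)
qed

lemma card_affine_image:
  assumes "coprime a p" "X \<subseteq> {0..<p}"
  shows "card (affine_image p a t X) = card X"
  unfolding affine_image_def using inj_on_subset[OF inj_on_affine[OF assms(1)] assms(2)] by (rule card_image)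

text \<open>Multiplication by \<open>a\<close> maps \<open>U\<close> onto itself, so the affine map
  can be pulled out of the sum.\<close>

lemma sumset_affine_image:
  assumes "affine_image p a 0 U = U"
  shows "sumset p (affine_image p a t X) U = affine_image p a t (sumset p X U)"
proof -
  have eq: "((a * x + t) mod p + (a * u) mod p) mod p = (a * ((x + u) mod p) + t) mod p" for x u
  proof -
    have "[(a * x + t) mod p + (a * u) mod p = (a * x + t) + a * u] (mod p)"
      by (simp add: cong_def mod_add_eq)
    moreover have "[a * ((x + u) mod p) + t = a * (x + u) + t] (mod p)"
      by (intro cong_add cong_mult cong_refl) (simp add: cong_def)
    ultimately show ?thesis by (simp add: cong_def algebra_simps)
  qed
  have U: "(a * u) mod p \<in> U" if "u \<in> U" for u
    using assms that unfolding affine_image_def by force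
  show ?thesis
  proof (intro equalityI subsetI)
    fix z assume "z \<in> sumset p (affine_image p a t X) U"
    then obtain x v where x: "x \<in> X" "v \<in> U" "z = ((a * x + t) mod p + v) mod p"
      by (auto elim!: sumsetE simp: affine_image_def)
    then obtain u where "u \<in> U" "v = (a * u) mod p" using assms unfolding affine_image_def by auto
    then have "z = (a * ((x + u) mod p) + t) mod p" using x eq by simp
    then show "z \<in> affine_image p a t (sumset p X U)"
      unfolding affine_image_def using x \<open>u \<in> U\<close> sumsetI by blast
  next
    fix z assume "z \<in> affine_image p a t (sumset p X U)"
    then obtain x u where x: "x \<in> X" "u \<in> U" "z = (a * ((x + u) mod p) + t) mod p"
      by (auto elim!: sumsetE simp: affine_image_def)
    then have "z = ((a * x + t) mod p + (a * u) mod p) mod p" using eq by simp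
    moreover have "(a * x + t) mod p \<in> affine_image p a t X" using x by (auto simp: affine_image_def)
    ultimately show "z \<in> sumset p (affine_image p a t X) U" using sumsetI U x by blast
  qed
qed

text \<open>A residue that is nonzero modulo the prime \<open>p\<close> generates Z_p
  additively.\<close>

lemma shift_closed_eq_univ:
  assumes "prime p" "X \<subseteq> {0..<int p}" "X \<noteq> {}" "\<not> int p dvd d"
    and closed: "\<And>x. x \<in> X \<Longrightarrow> (x + d) mod int p \<in> X"
  shows "X = {0..<int p}"
proof
  show "{0..<int p} \<subseteq> X"
  proof
    fix y assume y: "y \<in> {0..<int p}"
    obtain x where x: "x \<in> X" using assms(3) by blast
    obtain i where i: "[d * i = y - x] (mod int p)" using prime_cong_solve[OF assms(1,4)] by blast
    define k where "k = nat (i mod int p)"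
    have p: "int p > 0" using assms(1) prime_gt_0_nat by simp
    have "(x + int j * d) mod int p \<in> X" for j
    proof (induction j)
      case 0
      then show ?case using x assms(2) by auto
    next
      case (Suc j)
      have "((x + int j * d) mod int p + d) mod int p = (x + int (Suc j) * d) mod int p"
        by (simp add: mod_simps algebra_simps)
      then show ?case using closed[OF Suc] by simp
    qed
    moreover have "[x + int k * d = x + i * d] (mod int p)"
      using p by (intro cong_add cong_mult cong_refl) (simp add: k_def cong_def)
    then have "[x + int k * d = y] (mod int p)"
      using cong_trans[OF _ cong_add[OF cong_refl[of x] i]] by (simp add: algebra_simps)
    then have "(x + int k * d) mod int p = y" using y by (simp add: cong_def)
    ultimately show "y \<in> X" by metis
  qed
qed (use assms in simp)

text \<open>Davenport's transform: replace \<open>X\<close>, \<open>Y\<close> by the union and the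
  intersection of \<open>X\<close> with a translate of \<open>Y\<close>. The sum of the sizes is
  kept, the new sumset lies in the old one up to translation, and the second set shrinks.\<close>

lemma cauchy_davenport:
  assumes p: "prime p" and "X \<subseteq> {0..<int p}" "Y \<subseteq> {0..<int p}" "X \<noteq> {}" "Y \<noteq> {}"
  shows "min p (card X + card Y - 1) \<le> card (sumset (int p) X Y)"
  using assms(2-)
proof (induction "card Y" arbitrary: X Y rule: less_induct)
  case less
  have p0: "int p > 0" using p prime_gt_0_nat by simp
  have fin: "finite X" "finite Y" using less.prems finite_subset by blast+
  have shift_eq: "sumset (int p) Z (affine_image (int p) 1 t W) = affine_image (int p) 1 t (sumset (int p) Z W)"
    for Z W t
  proof (intro equalityI subsetI)
    fix z assume "z \<in> sumset (int p) Z (affine_image (int p) 1 t W)"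
    then obtain x y where "x \<in> Z" "y \<in> W" "z = (x + (y + t) mod int p) mod int p"
      by (auto elim!: sumsetE simp: affine_image_def)
    then show "z \<in> affine_image (int p) 1 t (sumset (int p) Z W)"
      unfolding affine_image_def using sumsetI[of x Z y W "int p"]
      by (intro image_eqI[of _ _ "(x + y) mod int p"]) (auto simp: mod_simps algebra_simps)
  next
    fix z assume "z \<in> affine_image (int p) 1 t (sumset (int p) Z W)"
    then obtain x y where xy: "x \<in> Z" "y \<in> W" "z = ((x + y) mod int p + t) mod int p"
      by (auto elim!: sumsetE simp: affine_image_def)
    then have "z = (x + (y + t) mod int p) mod int p" by (simp add: mod_simps algebra_simps)
    moreover have "(y + t) mod int p \<in> affine_image (int p) 1 t W"
      using xy(2) by (auto simp: affine_image_def)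
    ultimately show "z \<in> sumset (int p) Z (affine_image (int p) 1 t W)" using sumsetI xy(1) by blast
  qed
  obtain y1 where y1: "y1 \<in> Y" using less.prems by blast
  have "affine_image (int p) 1 y1 X \<subseteq> sumset (int p) X Y"
    unfolding affine_image_def using sumsetI[OF _ y1] by auto
  then have "card (affine_image (int p) 1 y1 X) \<le> card (sumset (int p) X Y)"
    by (rule card_mono[OF finite_sumset[OF p0]])
  then have X_le: "card X \<le> card (sumset (int p) X Y)"
    using card_affine_image[of 1 "int p" X y1] less.prems(1) by simp
  show ?case
  proof (cases "card Y \<le> 1")
    case True
    then show ?thesis using X_le by simp
  next
    case False
    then obtain y2 where y2: "y2 \<in> Y" "y2 \<noteq> y1" using card_ge_2_obtain by metis
    have nd: "\<not> int p dvd y2 - y1"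
    proof
      assume "int p dvd y2 - y1"
      then have "y2 mod int p = y1 mod int p" by (simp add: mod_eq_dvd_iff)
      then show False using y1 y2 less.prems(2) by (auto simp: subset_iff)
    qed
    show ?thesis
    proof (cases "X = {0..<int p}")
      case True
      then show ?thesis using X_le by simp
    next
      case False
      then obtain x where x: "x \<in> X" "(x + (y2 - y1)) mod int p \<notin> X"
        using shift_closed_eq_univ[OF p less.prems(1,3) nd] by blast
      \<comment> \<open>This translate has \<open>y1\<close> moved to \<open>x\<close>, inside
        \<open>X\<close>, and \<open>y2\<close> moved outside \<open>X\<close>, so its intersection
        with \<open>X\<close> is nonempty and proper.\<close>
      define Y' where "Y' = affine_image (int p) 1 (x - y1) Y"
      have Y': "Y' \<subseteq> {0..<int p}" "card Y' = card Y"
        unfolding Y'_def using affine_image_subset[OF p0] card_affine_image less.prems(2) by auto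
      have xY: "x \<in> Y'"
      proof -
        have "x mod int p = x" using x(1) less.prems(1) by auto
        then show ?thesis unfolding Y'_def affine_image_def
          by (intro image_eqI[of _ _ y1]) (simp_all add: y1)
      qed
      have "(x + (y2 - y1)) mod int p \<in> Y'"
        unfolding Y'_def affine_image_def
        by (intro image_eqI[of _ _ y2]) (simp_all add: y2 algebra_simps)
      then have psub: "X \<inter> Y' \<subset> Y'" using x(2) by blast
      have finY': "finite Y'" using Y'(1) finite_subset by blast
      have "card (X \<inter> Y') < card Y" using psubset_card_mono[OF finY' psub] Y'(2) by simp
      then have "min p (card (X \<union> Y') + card (X \<inter> Y') - 1) \<le> card (sumset (int p) (X \<union> Y') (X \<inter> Y'))"
        using less.hyps[of "X \<inter> Y'" "X \<union> Y'"] less.prems Y'(1) xY x(1) by blast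
      moreover have "card (X \<union> Y') + card (X \<inter> Y') = card X + card Y"
        using card_Un_Int[OF fin(1) finY'] Y'(2) by simp
      moreover have "sumset (int p) (X \<union> Y') (X \<inter> Y') \<subseteq> sumset (int p) X Y'"
      proof
        fix z assume "z \<in> sumset (int p) (X \<union> Y') (X \<inter> Y')"
        then obtain u v where uv: "u \<in> X \<union> Y'" "v \<in> X \<inter> Y'" "z = (u + v) mod int p" by (rule sumsetE)
        then show "z \<in> sumset (int p) X Y'"
          using sumsetI[of u X v Y' "int p"] sumsetI[of v X u Y' "int p"] by (auto simp: add.commute)
      qed
      then have "card (sumset (int p) (X \<union> Y') (X \<inter> Y')) \<le> card (sumset (int p) X Y')"
        by (rule card_mono[OF finite_sumset[OF p0]])
      moreover have "card (sumset (int p) X Y') = card (sumset (int p) X Y)"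
        unfolding Y'_def shift_eq using sumset_subset[OF p0] by (intro card_affine_image) auto
      ultimately show ?thesis by simp
    qed
  qed
qed

text \<open>\<open>F\<close> collects the sets at which Cauchy--Davenport is attained. Submodularity
  makes \<open>F\<close> stable under intersections, so a smallest member with at least two elements
  is rigid under the symmetries of \<open>U\<close>.\<close>

lemma no_critical_set:
  assumes p: "prime p" "odd p"
    and U: "U \<subseteq> {0..<int p}" "0 \<in> U" "U \<noteq> {0}"
    and neg: "affine_image (int p) (-1) 0 U = U" and dbl: "affine_image (int p) 2 0 U = U"
    and X: "X \<subseteq> {0..<int p}" "2 \<le> card X"
      "card (sumset (int p) X U) + 1 \<le> card X + card U" "2 * card X + card U \<le> p + 2"
  shows False
proof -
  have p0: "int p > 0" using p(1) prime_gt_0_nat by simp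
  have p3: "p \<ge> 3" using p prime_ge_2_nat[of p] by (cases "p = 2") auto
  define S where "S Y = sumset (int p) Y U" for Y
  define F where "F Y \<longleftrightarrow> Y \<subseteq> {0..<int p} \<and> Y \<noteq> {} \<and> card (S Y) + 1 \<le> card Y + card U" for Y
  have finU: "finite U" using U(1) finite_subset by blast
  have Une: "U \<noteq> {}" using U(2) by blast
  have cd: "card Y + card U \<le> card (S Y) + 1"
    if "Y \<subseteq> {0..<int p}" "Y \<noteq> {}" "card Y + card U \<le> p + 1" for Y
    using cauchy_davenport[OF p(1) that(1) U(1) that(2) Une] that(3) by (auto simp: S_def)
  have F_Int: "F (Y \<inter> Z)"
    \<comment> \<open>The sumset of the union is the union of the sumsets, and that of the
      intersection lies in both. The lower bound \<open>cd\<close> for the union then gives the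
      upper bound for the intersection.\<close>
    if "F Y" "F Z" "Y \<inter> Z \<noteq> {}" "card (Y \<union> Z) + card U \<le> p + 1" for Y Z
  proof -
    have Y: "Y \<subseteq> {0..<int p}" and Z: "Z \<subseteq> {0..<int p}" using that by (auto simp: F_def)
    have fin: "finite Y" "finite Z" using Y Z finite_subset by blast+
    have finS: "finite (S W)" for W unfolding S_def by (rule finite_sumset[OF p0])
    have "S (Y \<inter> Z) \<subseteq> S Y \<inter> S Z" unfolding S_def by (simp add: sumset_mono)
    then have 1: "card (S (Y \<inter> Z)) \<le> card (S Y \<inter> S Z)" using finS by (intro card_mono) auto
    have 2: "card (S Y) + card (S Z) = card (S (Y \<union> Z)) + card (S Y \<inter> S Z)"
      using card_Un_Int[OF finS finS] unfolding S_def sumset_Un .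
    have 3: "card (Y \<union> Z) + card U \<le> card (S (Y \<union> Z)) + 1"
      using Y Z that by (intro cd) auto
    have 4: "card Y + card Z = card (Y \<union> Z) + card (Y \<inter> Z)" using card_Un_Int[OF fin] .
    have "card (S Y) + 1 \<le> card Y + card U" "card (S Z) + 1 \<le> card Z + card U"
      using that by (auto simp: F_def)
    then have "card (S (Y \<inter> Z)) + 1 \<le> card (Y \<inter> Z) + card U" using 1 2 3 4 by linarith
    then show ?thesis using Y that(3) by (auto simp: F_def)
  qed
  have F_affine: "F (affine_image (int p) a t Y)"
    if "F Y" "coprime a (int p)" "affine_image (int p) a 0 U = U" for a t Y
  proof -
    have Y: "Y \<subseteq> {0..<int p}" "Y \<noteq> {}" "card (S Y) + 1 \<le> card Y + card U"
      using that by (auto simp: F_def)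
    have "card (S (affine_image (int p) a t Y)) = card (S Y)"
      unfolding S_def sumset_affine_image[OF that(3)]
      by (rule card_affine_image[OF that(2) sumset_subset[OF p0]])
    moreover have "card (affine_image (int p) a t Y) = card Y" using card_affine_image[OF that(2) Y(1)] .
    ultimately show ?thesis
      unfolding F_def using Y affine_image_subset[OF p0] by (simp add: affine_image_def)
  qed
  have "F X \<and> 2 \<le> card X" using X U by (auto simp: F_def S_def)
  then obtain M where M: "F M" "2 \<le> card M" and least: "\<And>Y. F Y \<Longrightarrow> 2 \<le> card Y \<Longrightarrow> card M \<le> card Y"
    using ex_has_least_nat[of "\<lambda>Y. F Y \<and> 2 \<le> card Y" X card] by blast
  have small: "2 * card M + card U \<le> p + 2" using least[of X] X(4) \<open>F X \<and> 2 \<le> card X\<close> by simp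
  have M_sub: "M \<subseteq> {0..<int p}" using M by (simp add: F_def)
  then have finM: "finite M" using finite_subset by blast
  have mod_M: "x mod int p = x" if "x \<in> M" for x using M_sub that by auto
  \<comment> \<open>The reflection exchanges \<open>x\<close> and \<open>y\<close> and preserves
    \<open>F\<close>. Its image of \<open>M\<close> shares two points with \<open>M\<close>, so
    minimality of \<open>M\<close> makes the two sets equal.\<close>
  have reflect: "affine_image (int p) (-1) (x + y) M = M" if "x \<in> M" "y \<in> M" "x \<noteq> y" for x y
  proof -
    let ?Y = "affine_image (int p) (-1) (x + y) M"
    have Y: "F ?Y" by (rule F_affine[OF M(1) _ neg]) simp
    have cY: "card ?Y = card M" using card_affine_image[OF _ M_sub] by simp
    have finY: "finite ?Y" unfolding affine_image_def using finM by simp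
    have "x \<in> ?Y" "y \<in> ?Y" unfolding affine_image_def
      using that mod_M by (auto intro: image_eqI[of _ _ y] image_eqI[of _ _ x])
    then have sub: "{x, y} \<subseteq> M \<inter> ?Y" using that by blast
    then have two: "2 \<le> card (M \<inter> ?Y)" using card_mono[OF _ sub] finM that(3) by simp
    have "card (M \<union> ?Y) + card (M \<inter> ?Y) = card M + card M"
      using card_Un_Int[OF finM finY] cY by simp
    then have "F (M \<inter> ?Y)" using sub two small by (intro F_Int[OF M(1) Y]) auto
    then have "card M \<le> card (M \<inter> ?Y)" using least two by blast
    then have "M \<inter> ?Y = M" using finM by (intro card_seteq) auto
    then have "M \<subseteq> ?Y" by blast
    then show ?thesis using card_subset_eq[OF finY _ cY[symmetric]] by simp
  qed
  obtain x y where xy: "x \<in> M" "y \<in> M" "x \<noteq> y" using card_ge_2_obtain[of M] M(2) by auto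
  have ndvd: "\<not> int p dvd v - u" if "u \<in> M" "v \<in> M" "u \<noteq> v" for u v
  proof
    assume "int p dvd v - u"
    then have "v mod int p = u mod int p" by (simp add: mod_eq_dvd_iff)
    then show False using mod_M that by simp
  qed
  \<comment> \<open>With a third element \<open>z\<close>, the reflections for \<open>x + y\<close>
    and \<open>x + z\<close> compose to translation by \<open>z - y\<close>, and \<open>M\<close>
    would be all of Z_p.\<close>
  have "M = {x, y}"
  proof (rule ccontr)
    assume "M \<noteq> {x, y}"
    then obtain z where z: "z \<in> M" "z \<noteq> x" "z \<noteq> y" using xy by blast
    have "M = {0..<int p}"
    proof (rule shift_closed_eq_univ[OF p(1) M_sub _ ndvd[OF xy(2) z(1)]])
      fix u assume "u \<in> M"
      then obtain w where w: "w \<in> M" "u = (- w + (x + y)) mod int p"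
        using reflect[OF xy] by (auto simp: affine_image_def)
      have "(- w + (x + z)) mod int p \<in> M"
        using reflect[OF xy(1) z(1)] w(1) z(2) by (auto simp: affine_image_def)
      moreover have "(u + (z - y)) mod int p = (- w + (x + y) + (z - y)) mod int p"
        unfolding w(2) by (rule mod_add_left_eq)
      ultimately show "(u + (z - y)) mod int p \<in> M" by (simp add: algebra_simps)
    qed (use xy z in auto)
    then have "card M = p" by simp
    moreover have "card U \<ge> 1" using finU Une by (simp add: Suc_leI card_gt_0_iff)
    ultimately show False using small p3 by linarith
  qed
  then have card_U: "card U + 2 \<le> p" and F_xy: "F {x, y}" using small M(1) xy(3) by auto
  define d where "d = y - x"
  \<comment> \<open>\<open>V t\<close> is the translate of \<open>U\<close> by \<open>t\<close>.
    Since \<open>{x, y}\<close> is in \<open>F\<close> and doubling preserves \<open>U\<close>, both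
    \<open>V d\<close> and \<open>V (2 * d)\<close> add at most one element to
    \<open>U\<close>.\<close>
  define V where "V t = affine_image (int p) 1 t U" for t
  have V_card: "card (V t) = card U" and V_fin: "finite (V t)" for t
    unfolding V_def using card_affine_image U(1) finU by (simp, simp add: affine_image_def)
  have V0: "V 0 = U" unfolding V_def affine_image_def using U(1) by force
  have S_V: "S (affine_image (int p) 1 0 T) = (\<Union>t\<in>T. V t)" for T
  proof (intro equalityI subsetI)
    fix z assume "z \<in> S (affine_image (int p) 1 0 T)"
    then obtain t u where tu: "t \<in> T" "u \<in> U" "z = (t mod int p + u) mod int p"
      unfolding S_def by (auto elim!: sumsetE simp: affine_image_def)
    then have "z = (1 * u + t) mod int p" by (simp add: mod_simps add.commute)
    then have "z \<in> V t" using tu(2) unfolding V_def affine_image_def by blast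
    then show "z \<in> (\<Union>t\<in>T. V t)" using tu(1) by blast
  next
    fix z assume "z \<in> (\<Union>t\<in>T. V t)"
    then obtain t u where tu: "t \<in> T" "u \<in> U" "z = (u + t) mod int p"
      by (auto simp: V_def affine_image_def)
    then have "z = (t mod int p + u) mod int p" by (simp add: mod_simps add.commute)
    moreover have "t mod int p \<in> affine_image (int p) 1 0 T" using tu(1) by (simp add: affine_image_def)
    ultimately show "z \<in> S (affine_image (int p) 1 0 T)" unfolding S_def using tu(2) sumsetI by blast
  qed
  have d: "\<not> int p dvd d" unfolding d_def using ndvd[OF xy] .
  have one: "affine_image (int p) 1 0 U = U" using V0 by (simp add: V_def)
  have two: "\<not> int p dvd 2 * d"
    using d p(2) coprime_dvd_mult_right_iff[of "int p" 2 d] by auto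
  have F_0d: "F (affine_image (int p) 1 0 {0, d})"
  proof -
    have "affine_image (int p) 1 0 {0, d} = affine_image (int p) 1 (- x) {x, y}"
      by (simp add: affine_image_def d_def)
    then show ?thesis using F_affine[OF F_xy _ one, of "- x"] by simp
  qed
  have F_02d: "F (affine_image (int p) 1 0 {0, 2 * d})"
  proof -
    have "affine_image (int p) 1 0 {0, 2 * d} = affine_image (int p) 2 (- 2 * x) {x, y}"
      by (simp add: affine_image_def d_def)
    then show ?thesis using F_affine[OF F_xy _ dbl, of "- 2 * x"] p(2) by simp
  qed
  have card2: "card (affine_image (int p) 1 0 {0, e}) \<le> 2" for e
    by (simp add: affine_image_def card_insert_if)
  have Vd: "card (U \<union> V d) \<le> card U + 1" and V2d: "card (U \<union> V (2 * d)) \<le> card U + 1"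
    using F_0d F_02d card2[of d] card2[of "2 * d"] V0 by (auto simp: F_def S_V)
  have "card (affine_image (int p) 1 0 {0, d, 2 * d}) = 3"
  proof -
    have "0 \<noteq> d mod int p" "0 \<noteq> (2 * d) mod int p" "d mod int p \<noteq> (2 * d) mod int p"
      using d two by (auto simp: mod_0_imp_dvd mod_eq_dvd_iff dest: sym)
    then show ?thesis by (simp add: affine_image_def)
  qed
  \<comment> \<open>Cauchy--Davenport for the three residues shows that \<open>V d\<close> is not
    covered by \<open>U\<close> and \<open>V (2 * d)\<close>.\<close>
  then have "card U + 2 \<le> card (S (affine_image (int p) 1 0 {0, d, 2 * d}))"
    using cd[of "affine_image (int p) 1 0 {0, d, 2 * d}"] card_U affine_image_subset[OF p0]
    by (auto simp: affine_image_def)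
  then have "card U + 2 \<le> card (U \<union> V (2 * d) \<union> V d)"
    unfolding S_V using V0 by (simp add: Un_commute Un_left_commute Un_assoc)
  then have "\<not> V d \<subseteq> U \<union> V (2 * d)" using V2d by (auto simp: Un_absorb2)
  then obtain w where w: "w \<in> V d" "w \<notin> U" "w \<notin> V (2 * d)" by blast
  then obtain u where u: "u \<in> U" "w = (u + d) mod int p" by (auto simp: V_def affine_image_def)
  have "card (V d - U) \<le> 1"
  proof -
    have "U \<union> V d = U \<union> (V d - U)" by blast
    then have "card (U \<union> V d) = card U + card (V d - U)"
      using card_Un_disjoint[of U "V d - U"] finU V_fin by auto
    then show ?thesis using Vd by simp
  qed
  then have only_w: "v = w" if "v \<in> V d" "v \<notin> U" for v
    using w that V_fin card_le_Suc0_iff_eq[of "V d - U"] by auto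
  \<comment> \<open>Only \<open>w\<close>, which is \<open>u + d\<close>, leaves \<open>U\<close>
    under translation by \<open>d\<close>, and \<open>z + d = u\<close> would put \<open>w\<close>
    into \<open>V (2 * d)\<close>. So \<open>U\<close> without \<open>u\<close> is closed under
    adding \<open>d\<close>.\<close>
  have "U - {u} = {}"
  proof (rule ccontr)
    assume ne: "U - {u} \<noteq> {}"
    have "U - {u} = {0..<int p}"
    proof (rule shift_closed_eq_univ[OF p(1) _ ne d])
      fix z assume z: "z \<in> U - {u}"
      have zV: "(z + d) mod int p \<in> V d" using z by (auto simp: V_def affine_image_def)
      have "(z + d) mod int p \<noteq> w"
      proof
        assume "(z + d) mod int p = w"
        then have "[z + d = u + d] (mod int p)" using u by (simp add: cong_def)
        then have "[z = u] (mod int p)" by (simp add: cong_add_rcancel)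
        then show False using z u U(1) by (auto simp: cong_def subset_iff)
      qed
      then have "(z + d) mod int p \<in> U" using only_w zV by blast
      moreover have "(z + d) mod int p \<noteq> u"
      proof
        assume "(z + d) mod int p = u"
        then have "w = (z + 2 * d) mod int p" using u(2) by (auto simp: mod_simps algebra_simps)
        then have "w \<in> V (2 * d)" using z by (auto simp: V_def affine_image_def)
        then show False using w(3) by blast
      qed
      ultimately show "(z + d) mod int p \<in> U - {u}" by blast
    qed (use U in auto)
    then show False using u U by blast
  qed
  then show False using U u by blast
qed

section \<open>Color classes modulo a prime\<close>

definition color_class :: "nat \<Rightarrow> (int \<Rightarrow> 'a) \<Rightarrow> 'a \<Rightarrow> int set" where
  "color_class p c X = {x \<in> {0..<int p}. c x = X}"

lemma finite_color_class: "finite (color_class p c X)"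
  by (rule finite_subset[of _ "{0..<int p}"]) (auto simp: color_class_def)

lemma mod_in_color_class:
  assumes "periodic (int p) c" "p > 0" "c x = X"
  shows "x mod int p \<in> color_class p c X"
  using assms by (simp add: color_class_def periodic_def)

lemma card_color_class_pos:
  assumes "periodic (int p) c" "p > 0" "X \<in> range c"
  shows "0 < card (color_class p c X)"
proof -
  obtain x where "c x = X" using assms(3) by blast
  then have "color_class p c X \<noteq> {}" using mod_in_color_class[OF assms(1,2)] by blast
  then show ?thesis by (simp add: card_gt_0_iff finite_color_class)
qed

lemma card_three_color_classes:
  assumes dist: "A \<noteq> B" "B \<noteq> C" "A \<noteq> C" and rng: "range c = {A, B, C}"
  shows "card (color_class p c A) + card (color_class p c B) + card (color_class p c C) = p"
proof -
  define cA cB cC where "cA = color_class p c A" and "cB = color_class p c B" and "cC = color_class p c C"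
  have fin: "finite cA" "finite cB" "finite cC" by (simp_all add: cA_def cB_def cC_def finite_color_class)
  have "cA \<union> cB \<union> cC = {0..<int p}"
  proof
    show "{0..<int p} \<subseteq> cA \<union> cB \<union> cC"
    proof
      fix x assume "x \<in> {0..<int p}"
      moreover have "c x \<in> {A, B, C}" using rng by blast
      ultimately show "x \<in> cA \<union> cB \<union> cC" by (auto simp: cA_def cB_def cC_def color_class_def)
    qed
  qed (auto simp: cA_def cB_def cC_def color_class_def)
  moreover have "cA \<inter> cB = {}" "(cA \<union> cB) \<inter> cC = {}"
    using dist by (auto simp: cA_def cB_def cC_def color_class_def)
  ultimately have "card cA + card cB + card cC = card {0..<int p}"
    using card_Un_disjoint[of cA cB] card_Un_disjoint[of "cA \<union> cB" cC] fin by simp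
  then show ?thesis by (simp add: cA_def cB_def cC_def)
qed

text \<open>Adding a non-adjacent difference to the class of \<open>A\<close> never reaches
  \<open>C\<close>, so Cauchy--Davenport bounds \<open>U\<close> by the class of \<open>B\<close>
  plus one. Equality is excluded by \<open>no_critical_set\<close>, whose size condition follows
  from \<open>le\<close>.\<close>

lemma card_nonadjacent_le:
  assumes p: "prime p" "odd p" and c: "periodic (int p) c" "rainbow_free c"
    and dist: "A \<noteq> B" "B \<noteq> C" "A \<noteq> C" and rng: "range c = {A, B, C}"
    and le: "card (color_class p c A) \<le> card (color_class p c C)"
    and two: "2 \<le> card (color_class p c A)" "2 \<le> card (color_class p c B)"
  shows "card {d \<in> {0..<int p}. \<not> adjacent c d A C} \<le> card (color_class p c B)"
proof (rule ccontr)
  define U where "U = {d \<in> {0..<int p}. \<not> adjacent c d A C}"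
  define cA cB cC where "cA = color_class p c A" and "cB = color_class p c B" and "cC = color_class p c C"
  assume "\<not> card {d \<in> {0..<int p}. \<not> adjacent c d A C} \<le> card (color_class p c B)"
  then have big: "card cB + 1 \<le> card U" by (simp add: U_def cB_def)
  have p0: "p > 0" using p(1) prime_gt_0_nat by blast
  have U_sub: "U \<subseteq> {0..<int p}" by (auto simp: U_def)
  then have finU: "finite U" using finite_subset by blast
  have fin: "finite cA" "finite cB" "finite cC" by (simp_all add: cA_def cB_def cC_def finite_color_class)
  have total: "p = card cA + card cB + card cC"
    unfolding cA_def cB_def cC_def using card_three_color_classes[OF dist rng] by simp
  have disj: "cA \<inter> cB = {}" using dist by (auto simp: cA_def cB_def color_class_def)
  have sub: "sumset (int p) cA U \<subseteq> cA \<union> cB"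
  proof
    fix z assume "z \<in> sumset (int p) cA U"
    then obtain x d where xd: "x \<in> cA" "d \<in> U" "z = (x + d) mod int p" by (rule sumsetE)
    have "c (x + d) \<noteq> C" using xd adjacentI[of c x A d C] by (auto simp: U_def cA_def color_class_def)
    moreover have "c (x + d) \<in> {A, B, C}" using rng by blast
    ultimately have "c (x + d) = A \<or> c (x + d) = B" by blast
    then show "z \<in> cA \<union> cB"
      using mod_in_color_class[OF c(1) p0] xd(3) by (auto simp: cA_def cB_def)
  qed
  have sum_le: "card (sumset (int p) cA U) \<le> card cA + card cB"
    using card_mono[OF _ sub] fin card_Un_disjoint[OF _ _ disj] by simp
  have A2: "2 \<le> card cA" "2 \<le> card cB" "card cA \<le> card cC" using two le by (simp_all add: cA_def cB_def cC_def)
  have cA_sub: "cA \<subseteq> {0..<int p}" by (auto simp: cA_def color_class_def)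
  have zero: "0 \<in> U" using p0 not_adjacent_multiple[OF c(1) _ dist(3)] by (simp add: U_def)
  have "min p (card cA + card U - 1) \<le> card (sumset (int p) cA U)"
    by (rule cauchy_davenport[OF p(1) cA_sub U_sub]) (use A2 zero in auto)
  then have U_card: "card U = card cB + 1" using sum_le total A2 big by auto
  \<comment> \<open>An injective map of the finite set \<open>U\<close> into itself is onto.\<close>
  have closed: "affine_image (int p) a 0 U = U"
    if "coprime a (int p)" "\<And>d. \<not> adjacent c d A C \<Longrightarrow> \<not> adjacent c (a * d) A C" for a
  proof -
    have "affine_image (int p) a 0 U \<subseteq> U"
    proof
      fix z assume "z \<in> affine_image (int p) a 0 U"
      then obtain d where d: "d \<in> U" "z = (a * d) mod int p" by (auto simp: affine_image_def)
      have "[z = a * d] (mod int p)" using d by (simp add: cong_def)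
      then have "\<not> adjacent c z A C" using that(2)[of d] d(1) adjacent_cong[OF c(1)] by (simp add: U_def)
      then show "z \<in> U" using d(2) p0 by (simp add: U_def)
    qed
    then show ?thesis using card_subset_eq[OF finU] card_affine_image[OF that(1) U_sub] by blast
  qed
  show False
  proof (rule no_critical_set[OF p U_sub zero])
    show "U \<noteq> {0}" using U_card A2 by auto
    show "affine_image (int p) (-1) 0 U = U" by (rule closed) (simp_all add: adjacent_uminus)
    show "affine_image (int p) 2 0 U = U"
      by (rule closed) (use p(2) not_adjacent_double[OF p(1) c dist rng] in auto)
    show "cA \<subseteq> {0..<int p}" by (rule cA_sub)
  qed (use A2 sum_le U_card total in auto)
qed

text \<open>Every difference is non-adjacent for some pair of colors, and 0 for all pairs. If all
  classes had two elements, counting nonzero differences would give \<open>p - 1\<close> at most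
  \<open>p - 3\<close>.\<close>

lemma three_coloring_singleton:
  assumes p: "prime p" "odd p" and c: "periodic (int p) c" "rainbow_free c"
    and dist: "A \<noteq> B" "B \<noteq> C" "A \<noteq> C" and rng: "range c = {A, B, C}"
  shows "card (color_class p c A) = 1 \<or> card (color_class p c B) = 1 \<or> card (color_class p c C) = 1"
proof (rule ccontr)
  assume neg: "\<not> ?thesis"
  have p0: "p > 0" using p(1) prime_gt_0_nat by blast
  have two: "2 \<le> card (color_class p c X)" if "X \<in> {A, B, C}" for X
    using card_color_class_pos[OF c(1) p0, of X] neg that rng by auto
  define N where "N X Y = {d \<in> {0..<int p}. \<not> adjacent c d X Y}" for X Y
  have finN: "finite (N X Y)" for X Y
    by (rule finite_subset[of _ "{0..<int p}"]) (auto simp: N_def)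
  \<comment> \<open>Exchanging \<open>X\<close> and \<open>Z\<close> if necessary provides the size
    comparison required by \<open>card_nonadjacent_le\<close>.\<close>
  have bound: "card (N X Z) \<le> card (color_class p c Y)"
    if "X \<noteq> Y" "Y \<noteq> Z" "X \<noteq> Z" "{X, Y, Z} = {A, B, C}" for X Y Z
  proof (cases "card (color_class p c X) \<le> card (color_class p c Z)")
    case True
    then show ?thesis using that rng two unfolding N_def by (intro card_nonadjacent_le[OF p c]) auto
  next
    case False
    have "card (N Z X) \<le> card (color_class p c Y)"
      using that rng two False unfolding N_def by (intro card_nonadjacent_le[OF p c]) auto
    then show ?thesis by (simp add: N_def adjacent_commute[of c _ Z X])
  qed
  have "{0..<int p} \<subseteq> N A C \<union> N A B \<union> N B C"
    using not_all_adjacent[OF p(1) c dist rng] unfolding N_def by blast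
  moreover have "{1..<int p} \<subseteq> {0..<int p} - {0}" by auto
  ultimately have sub: "{1..<int p} \<subseteq> (N A C - {0}) \<union> (N A B - {0}) \<union> (N B C - {0})" by blast
  have "p - 1 \<le> card ((N A C - {0}) \<union> (N A B - {0}) \<union> (N B C - {0}))"
    using card_mono[OF _ sub] finN by simp
  also have "\<dots> \<le> card (N A C - {0}) + card (N A B - {0}) + card (N B C - {0})"
    by (rule order_trans[OF card_Un_le add_right_mono[OF card_Un_le]])
  also have "\<dots> = (card (N A C) - 1) + (card (N A B) - 1) + (card (N B C) - 1)"
  proof -
    have "card (N X Y - {0}) = card (N X Y) - 1" if "X \<noteq> Y" for X Y
      using p0 not_adjacent_multiple[OF c(1) _ that, of 0] by (intro card_Diff_singleton) (auto simp: N_def)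
    then show ?thesis using dist by simp
  qed
  also have "\<dots> \<le> (card (color_class p c B) - 1) + (card (color_class p c C) - 1) + (card (color_class p c A) - 1)"
    using bound[of A B C] bound[of A C B] bound[of B A C] dist
    by (intro add_mono diff_le_mono) auto
  finally have "p - 1 \<le> \<dots>" .
  then show False
    using card_three_color_classes[OF dist rng, of p] two[of A] two[of B] two[of C] by simp
qed

text \<open>With four colors, merging two of them yields a class of at least two elements, so among
  any two colors one has a singleton class. Hence two classes are singletons, and reflecting one in
  the other gives a contradiction.\<close>

lemma max_colors_prime_le_3:
  assumes "prime p"
  shows "max_colors p \<le> 3"
proof (rule ccontr)
  assume big: "\<not> max_colors p \<le> 3"
  have p0: "p > 0" using assms prime_gt_0_nat by blast
  have "odd p" using assms big max_colors_le[OF p0] prime_odd_nat[of p] by (cases "p > 2") auto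
  obtain c :: "int \<Rightarrow> nat" where c: "periodic (int p) c" "rainbow_free c" "range c = {1..4}"
    using obtain_coloring[OF p0, of 4] big by auto
  have single: "card (color_class p c i) = 1 \<or> card (color_class p c j) = 1"
    if ij: "i \<in> {1..4}" "j \<in> {1..4}" "i \<noteq> j" for i j
  proof -
    \<comment> \<open>The value 0 lies outside \<open>{1..4}\<close> and serves as the merged
      color.\<close>
    define h where "h k = (if k = i \<or> k = j then k else 0)" for k
    define f where "f x = h (c x)" for x
    have pos: "i > 0" "j > 0" using ij by auto
    have f: "periodic (int p) f" "rainbow_free f"
      unfolding f_def using periodic_comp[OF c(1)] rainbow_free_comp[OF c(2)] by auto
    have "\<not> card ({1..4} - {i, j}) \<le> 1" using ij by (simp add: card_Diff_subset)
    then obtain k l where kl: "k \<in> {1..4} - {i, j}" "l \<in> {1..4} - {i, j}" "k \<noteq> l"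
      by (rule card_ge_2_obtain)
    have "range f = h ` {1..4}" unfolding f_def c(3)[symmetric] by (simp add: image_image)
    also have "\<dots> = {0, i, j}" using ij kl by (auto simp: h_def image_iff)
    finally have rng: "range f = {0, i, j}" .
    obtain x y where xy: "c x = k" "c y = l" using kl c(3) by (metis DiffD1 imageE)
    have "f x = 0" "f y = 0" using xy kl by (auto simp: f_def h_def)
    then have "{x mod int p, y mod int p} \<subseteq> color_class p f 0"
      using mod_in_color_class[OF f(1) p0, of x 0] mod_in_color_class[OF f(1) p0, of y 0] by simp
    moreover have "x mod int p \<noteq> y mod int p" using xy kl(3) c(1) by (metis periodic_def)
    ultimately have "2 \<le> card (color_class p f 0)"
      using card_mono[of "color_class p f 0" "{x mod int p, y mod int p}"] by (simp add: finite_color_class)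
    moreover have "color_class p f i = color_class p c i" "color_class p f j = color_class p c j"
      using pos by (auto simp: color_class_def f_def h_def)
    ultimately show ?thesis
      using three_coloring_singleton[OF assms \<open>odd p\<close> f, of 0 i j] rng ij(3) pos by auto
  qed
  obtain i j where ij: "i \<in> {1..4}" "j \<in> {1..4}" "i \<noteq> j"
    "card (color_class p c i) = 1" "card (color_class p c j) = 1"
  proof -
    consider "card (color_class p c 1) = 1" "card (color_class p c 2) = 1"
      | "card (color_class p c 1) = 1" "card (color_class p c 3) = 1"
      | "card (color_class p c 2) = 1" "card (color_class p c 3) = 1"
      using single[of 1 2] single[of 1 3] single[of 2 3] by auto
    then show thesis by cases (use that[of 1 2] that[of 1 3] that[of 2 3] in auto)
  qed
  obtain x y where xy: "color_class p c i = {x}" "color_class p c j = {y}"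
    using ij(4,5) by (metis card_1_singletonE)
  then have cx: "c x = i" "c y = j" by (auto simp: color_class_def)
  have "c (2 * y - x) = i \<or> c (2 * y - x) = j"
    using rainbow_freeD[OF c(2), of x "2 * y - x" y] cx ij(3) by auto
  then have "(2 * y - x) mod int p = x \<or> (2 * y - x) mod int p = y"
    using mod_in_color_class[OF c(1) p0, of "2 * y - x"] xy by auto
  then have "[2 * y - x = x] (mod int p) \<or> [2 * y - x = y] (mod int p)"
    by (metis cong_mod_left cong_refl)
  then have "[2 * y = 2 * x] (mod int p) \<or> [y = x] (mod int p)"
    by (auto simp: cong_iff_dvd_diff algebra_simps)
  then have "[y = x] (mod int p)" using cong_double_cancel \<open>odd p\<close> by auto
  then show False using periodicD[OF c(1)] cx ij(3) by metis
qed

section \<open>The formula for the maximal number of colors\<close>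

lemma max_colors_ge_2:
  assumes "n \<ge> 2"
  shows "max_colors n \<ge> 2"
proof -
  let ?c = "\<lambda>x. int n dvd x"
  have "periodic (int n) ?c" by (simp add: periodic_def dvd_mod_iff)
  moreover have "rainbow_free ?c" by (auto simp: rainbow_free_def)
  moreover have "range ?c = {True, False}"
  proof -
    have "?c 0" "\<not> ?c 1" using assms by auto
    then show ?thesis by (metis (full_types) UNIV_bool insert_commute surj_def)
  qed
  ultimately show ?thesis using card_range_le_max_colors[of n ?c] assms by simp
qed

text \<open>The coloring fed into \<open>max_colors_mult_ge\<close> is the singleton 3-coloring if
  \<open>p\<close> admits three colors, and divisibility by \<open>p\<close> otherwise.\<close>

lemma max_colors_prime_mult_ge:
  assumes p: "prime p" "odd p" and m: "m > 0"
  shows "max_colors m + max_colors p \<le> max_colors (p * m) + 1"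
proof (cases "max_colors p \<ge> 3")
  case True
  then obtain c0 :: "int \<Rightarrow> nat" where c0: "periodic (int p) c0" "rainbow_free c0"
    "\<And>x. c0 x = c0 0 \<longleftrightarrow> int p dvd x" "card (range c0) = 3"
    using obtain_singleton_3_coloring[OF p] by blast
  have "max_colors p = 3" using True max_colors_prime_le_3[OF p(1)] by simp
  then show ?thesis using max_colors_mult_ge[OF p(2) m c0(1-3)] c0(4) by simp
next
  case False
  have p2: "p \<ge> 2" using p(1) prime_ge_2_nat by blast
  let ?c = "\<lambda>x. int p dvd x"
  have "periodic (int p) ?c" by (simp add: periodic_def dvd_mod_iff)
  moreover have "rainbow_free ?c" by (auto simp: rainbow_free_def)
  moreover have "range ?c = {True, False}"
  proof -
    have "?c 0" "\<not> ?c 1" using p2 by auto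
    then show ?thesis by (metis (full_types) UNIV_bool insert_commute surj_def)
  qed
  ultimately have "max_colors m + 2 \<le> max_colors (p * m) + 1"
    using max_colors_mult_ge[OF p(2) m, of ?c] by simp
  then show ?thesis using False by simp
qed

text \<open>An odd prime contributes \<open>max_colors p - 1\<close> to the formula, namely 1 or 2;
  the summand 1 on the left avoids natural subtraction.\<close>

lemma prime_factor_weight:
  assumes p: "prime p" "odd p" and m: "m > 0"
  shows "f3 (p * m) + 2 * f4 (p * m) + 1 = f3 m + 2 * f4 m + max_colors p"
proof -
  have pf: "prime_factorization (p * m) = add_mset p (prime_factorization m)"
    using p(1) m by (subst prime_factorization_mult) (auto simp: prime_factorization_prime)
  have "aw p (Zmod p) 3 = max_colors p + 1" using p(1) prime_gt_0_nat by (intro aw_eq_max_colors) auto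
  moreover have "max_colors p = 2 \<or> max_colors p = 3"
    using max_colors_prime_le_3[OF p(1)] max_colors_ge_2[of p] p(1) prime_ge_2_nat[of p] by linarith
  ultimately show ?thesis unfolding f3_def f4_def pf using p(2) by auto
qed

lemma f3_f4_double:
  assumes "m > 0"
  shows "f3 (2 * m) = f3 m" "f4 (2 * m) = f4 m"
proof -
  have pf: "prime_factorization (2 * m) = add_mset 2 (prime_factorization m)"
    using assms by (subst prime_factorization_mult) (auto simp: prime_factorization_prime)
  show "f3 (2 * m) = f3 m" "f4 (2 * m) = f4 m" unfolding f3_def f4_def pf by simp_all
qed

lemma f3_f4_power2_mult: "m > 0 \<Longrightarrow> f3 (2 ^ e * m) = f3 m \<and> f4 (2 ^ e * m) = f4 m"
proof (induction e)
  case (Suc e)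
  then show ?case using f3_f4_double[of "2 ^ e * m"] by (simp add: mult.assoc)
qed simp

text \<open>Odd primes are split off one by one. What remains is a power of 2, where one color, or
  two if it is even, suffices for the bound.\<close>

lemma max_colors_lower:
  assumes "n > 0"
  shows "1 + f2 n + f3 n + 2 * f4 n \<le> max_colors n"
  using assms
proof (induction n rule: less_induct)
  case (less n)
  show ?case
  proof (cases "\<exists>p. prime p \<and> odd p \<and> p dvd n")
    case True
    then obtain p m where p: "prime p" "odd p" and n: "n = p * m" by blast
    have m: "m > 0" "m < n" using less.prems n p(1) prime_gt_1_nat[of p] by auto
    have "f2 n = f2 m" using n p(2) by (simp add: f2_def)
    then show ?thesis
      using less.IH[OF m(2,1)] max_colors_prime_mult_ge[OF p m(1)] prime_factor_weight[OF p m(1)] n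
      by simp
  next
    case False
    have "{#p \<in># prime_factorization n. odd p \<and> P p#} = {#}" for P
    proof -
      have "set_mset {#p \<in># prime_factorization n. odd p \<and> P p#} = {}"
        using False by (auto simp: in_prime_factors_iff)
      then show ?thesis by (simp only: set_mset_eq_empty_iff)
    qed
    then have "f3 n = 0" "f4 n = 0" by (simp_all add: f3_def f4_def)
    moreover have "1 + f2 n \<le> max_colors n"
      using max_colors_ge_1[OF less.prems] max_colors_ge_2[of n] less.prems
      by (cases "odd n") (auto simp: f2_def elim: evenE)
    ultimately show ?thesis by simp
  qed
qed

lemma max_colors_upper_odd:
  assumes "odd n"
  shows "max_colors n \<le> 1 + f3 n + 2 * f4 n"
  using assms
proof (induction n rule: less_induct)
  case (less n)
  show ?case
  proof (cases "n = 1")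
    case True
    then show ?thesis using max_colors_le[of 1] by simp
  next
    case False
    then obtain p where p: "prime p" "p dvd n" using prime_factor_nat by blast
    then obtain m where n: "n = p * m" by blast
    have odd: "odd p" "odd m" using less.prems n by auto
    have m: "m > 0" "m < n" using odd_pos[OF less.prems] n p(1) prime_gt_1_nat[of p] by auto
    show ?thesis
      using less.IH[OF m(2) odd(2)] max_colors_mult_odd_le[OF odd] prime_factor_weight[OF p(1) odd(1) m(1)] n
      by simp
  qed
qed

lemma max_colors_eq:
  assumes "n > 0"
  shows "max_colors n = 1 + f2 n + f3 n + 2 * f4 n"
proof (rule antisym)
  show "max_colors n \<le> 1 + f2 n + f3 n + 2 * f4 n"
  proof (cases "odd n")
    case True
    then show ?thesis using max_colors_upper_odd by (simp add: f2_def)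
  next
    case False
    obtain e s where s: "n = 2 ^ e * s" "odd s"
      using prime_power_canonical[of 2 n] assms by (metis mult.commute two_is_prime_nat)
    then obtain k where k: "e = Suc k" using False by (cases e) auto
    \<comment> \<open>The whole power of 2 is removed at once for a single color, which
      \<open>f2\<close> accounts for.\<close>
    have "max_colors n \<le> max_colors s + 1" using max_colors_power2_mult_le[OF s(2), of k] s(1) k by simp
    also have "\<dots> \<le> 2 + f3 s + 2 * f4 s" using max_colors_upper_odd[OF s(2)] by simp
    also have "\<dots> = 1 + f2 n + f3 n + 2 * f4 n"
      using f3_f4_power2_mult[OF odd_pos[OF s(2)], of e] False s(1) by (simp add: f2_def)
    finally show ?thesis .
  qed
qed (rule max_colors_lower[OF assms])

section \<open>Primes below 100\<close>

text \<open>The solutions of \<open>x ^ m = 1\<close> form a subgroup containing 2 and, as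
  \<open>m\<close> is even, -1. Coloring zero, this subgroup and the remaining units separately is
  invariant under doubling and negation; \<open>y\<close> shows that the third class is
  inhabited.\<close>

lemma max_colors_ge_3_power:
  assumes p: "prime p" and m: "even m" "[2 ^ m = 1] (mod int p)"
    and y: "\<not> [y ^ m = 1] (mod int p)" "\<not> int p dvd y" and "odd p"
  shows "max_colors p \<ge> 3"
proof -
  define c :: "int \<Rightarrow> nat" where
    "c x = (if int p dvd x then 0 else if [x ^ m = 1] (mod int p) then 1 else 2)" for x
  have per: "periodic (int p) c"
  proof (rule periodicI)
    fix u v assume uv: "[u = v] (mod int p)"
    then have "[u ^ m = v ^ m] (mod int p)" by (rule cong_pow)
    then have "[u ^ m = 1] (mod int p) \<longleftrightarrow> [v ^ m = 1] (mod int p)" by (metis cong_sym cong_trans)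
    then show "c u = c v" using cong_dvd_iff[OF uv] by (simp add: c_def)
  qed
  moreover have "rainbow_free c"
  proof (rule rainbow_free_invariant[OF per, of 1 2])
    fix x
    have "int p dvd 2 * x \<longleftrightarrow> int p dvd x"
      using \<open>odd p\<close> by (intro coprime_dvd_mult_right_iff) auto
    moreover have "[(2 * x) ^ m = x ^ m] (mod int p)"
      using cong_mult[OF m(2) cong_refl[of "x ^ m"]] by (simp add: power_mult_distrib)
    then have "[(2 * x) ^ m = 1] (mod int p) \<longleftrightarrow> [x ^ m = 1] (mod int p)"
      by (metis cong_sym cong_trans)
    ultimately show "c (2 * x) = c x" by (simp add: c_def)
    show "c (- x) = c x" using m(1) by (simp add: c_def)
  qed (simp add: c_def)
  ultimately have "card (range c) \<le> max_colors p"
    using p prime_gt_0_nat by (intro card_range_le_max_colors) auto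
  moreover have "{0, 1, 2} \<subseteq> range c"
  proof -
    have "c 0 = 0" "c y = 2" using y by (simp_all add: c_def)
    moreover have "c 1 = 1" using p by (auto simp: c_def)
    ultimately show ?thesis by (metis empty_subsetI insert_subset rangeI)
  qed
  then have "card {0, 1, 2 :: nat} \<le> card (range c)"
    using finite_range_periodic[OF per] p prime_gt_0_nat by (intro card_mono) auto
  ultimately show ?thesis by simp
qed

text \<open>Executable enumeration with the newest power at the head; the list \<open>[1..p]\<close>
  only counts the steps.\<close>

definition powers_of_2_mod :: "int \<Rightarrow> int list" where
  "powers_of_2_mod p = fold (\<lambda>_ l. (2 * hd l mod p) # l) [1..p] [1]"

definition signed_powers_of_2_cover :: "int \<Rightarrow> bool" where
  "signed_powers_of_2_cover p \<longleftrightarrow>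
     (let L = powers_of_2_mod p in \<forall>y \<in> set [1..p - 1]. y \<in> set L \<or> p - y \<in> set L)"

lemma powers_of_2_modD:
  assumes "x \<in> set (powers_of_2_mod p)"
  shows "\<exists>k. [x = 2 ^ k] (mod p)"
proof -
  have step: "\<exists>k. [2 * z mod p = 2 ^ k] (mod p)" if z: "\<exists>k. [z = 2 ^ k] (mod p)" for z :: int
  proof -
    obtain k where "[z = 2 ^ k] (mod p)" using z by blast
    then have "[2 * z = 2 * 2 ^ k] (mod p)" by (rule cong_scalar_left)
    then have "[2 * z mod p = 2 ^ Suc k] (mod p)" by (simp add: cong_def)
    then show ?thesis by blast
  qed
  have orbit: "\<forall>x \<in> set (fold (\<lambda>_ l. (2 * hd l mod p) # l) js l). \<exists>k. [x = 2 ^ k] (mod p)"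
    if "l \<noteq> []" "\<forall>x \<in> set l. \<exists>k. [x = 2 ^ k] (mod p)" for js :: "int list" and l
    using that
  proof (induction js arbitrary: l)
    case (Cons j js)
    show ?case unfolding fold_simps
      by (rule Cons.IH) (use Cons.prems step[of "hd l"] in auto)
  qed simp
  have "\<exists>k. [1 = 2 ^ k] (mod p)" by (rule exI[of _ 0]) simp
  then have "\<forall>x \<in> set [1]. \<exists>k. [x = 2 ^ k] (mod p)" by simp
  from orbit[OF _ this, of "[1..p]"] show ?thesis
    using assms unfolding powers_of_2_mod_def by blast
qed

lemma max_colors_le_2_cover:
  assumes p: "prime p" and cover: "signed_powers_of_2_cover (int p)"
  shows "max_colors p \<le> 2"
proof (rule max_colors_prime_le_2[OF p])
  fix y assume y: "\<not> int p dvd y"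
  have p0: "int p > 0" using p prime_gt_0_nat by simp
  define z where "z = y mod int p"
  have yz: "[y = z] (mod int p)" by (simp add: z_def cong_def)
  have "z \<noteq> 0" using y by (auto simp: z_def)
  moreover have "0 \<le> z" "z < int p" using p0 by (simp_all add: z_def)
  ultimately have "z \<in> set [1..int p - 1]" by auto
  then have "z \<in> set (powers_of_2_mod (int p)) \<or> int p - z \<in> set (powers_of_2_mod (int p))"
    using cover unfolding signed_powers_of_2_cover_def Let_def by blast
  then obtain k where "[z = 2 ^ k] (mod int p) \<or> [int p - z = 2 ^ k] (mod int p)"
    using powers_of_2_modD by blast
  then show "\<exists>k. [y = 2 ^ k] (mod int p) \<or> [y = - (2 ^ k)] (mod int p)"
  proof
    assume "[z = 2 ^ k] (mod int p)"
    then show ?thesis using cong_trans[OF yz] by blast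
  next
    assume "[int p - z = 2 ^ k] (mod int p)"
    then have "[- (int p - z) = - (2 ^ k)] (mod int p)"
      using cong_minus_minus_iff by blast
    moreover have "[z = - (int p - z)] (mod int p)" by (simp add: cong_iff_dvd_diff)
    ultimately show ?thesis using yz cong_trans by blast
  qed
qed

text \<open>An odd composite number below 100 has a prime factor 3, 5 or 7, so testing these
  divisors by evaluation finds all the primes.\<close>

lemma odd_primes_less_100:
  assumes "prime p" "odd p" "p < (100::nat)"
  shows "p \<in> {3, 5, 7, 11, 13, 19, 23, 29, 37, 47, 53, 59, 61, 67, 71, 79, 83} \<union> Q4"
proof -
  have d: "q dvd p \<Longrightarrow> q = 1 \<or> q = p" for q using assms(1) by (simp add: prime_nat_iff)
  have all: "\<forall>p \<in> set [0..<100]. odd p \<and> p \<noteq> 1 \<and> (3 dvd p \<longrightarrow> 3 = p) \<and> (5 dvd p \<longrightarrow> 5 = p) \<and> (7 dvd p \<longrightarrow> 7 = p)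
      \<longrightarrow> p \<in> {3, 5, 7, 11, 13, 19, 23, 29, 37, 47, 53, 59, 61, 67, 71, 79, 83} \<union> Q4"
    unfolding Q4_def by code_simp
  have mem: "p \<in> set [0..<100]" using assms(3) by simp
  have "p \<noteq> 1" using assms(1) by auto
  then show ?thesis
    by (intro mp[OF bspec[OF all mem]]) (use assms(2) d[of 3] d[of 5] d[of 7] in simp)
qed

lemma signed_powers_of_2_cover_Q3:
  "\<forall>p \<in> set [3, 5, 7, 11, 13, 19, 23, 29, 37, 47, 53, 59, 61, 67, 71, 79, 83]. signed_powers_of_2_cover p"
  by code_simp

lemma max_colors_Q3:
  assumes "prime p" "p \<in> {3, 5, 7, 11, 13, 19, 23, 29, 37, 47, 53, 59, 61, 67, 71, 79, 83}"
  shows "max_colors p = 2"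
proof -
  have "int p \<in> set [3, 5, 7, 11, 13, 19, 23, 29, 37, 47, 53, 59, 61, 67, 71, 79, 83]"
    using assms(2) by auto
  then have "max_colors p \<le> 2"
    using signed_powers_of_2_cover_Q3 by (intro max_colors_le_2_cover[OF assms(1)]) blast
  moreover have "max_colors p \<ge> 2" using max_colors_ge_2 prime_ge_2_nat[OF assms(1)] .
  ultimately show ?thesis by simp
qed

lemma max_colors_Q4:
  assumes "prime p" "p \<in> Q4"
  shows "max_colors p = 3"
proof -
  \<comment> \<open>The exponents below are the orders of the subgroups generated by \<open>2\<close> and \<open>-1\<close>.\<close>
  note ge_3 = max_colors_ge_3_power[OF assms(1)]
  consider "p = 17" | "p = 31" | "p = 41" | "p = 43" | "p = 73" | "p = 89" | "p = 97"
    using assms(2) unfolding Q4_def by blast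
  then have "max_colors p \<ge> 3"
  proof cases
    case 1 then show ?thesis using ge_3[of 8 3] by (simp add: cong_def)
  next
    case 2 then show ?thesis using ge_3[of 10 3] by (simp add: cong_def)
  next
    case 3 then show ?thesis using ge_3[of 20 3] by (simp add: cong_def)
  next
    case 4 then show ?thesis using ge_3[of 14 3] by (simp add: cong_def)
  next
    case 5 then show ?thesis using ge_3[of 18 3] by (simp add: cong_def)
  next
    case 6 then show ?thesis using ge_3[of 22 3] by (simp add: cong_def)
  next
    \<comment> \<open>Modulo 97 the subgroup of order 48 consists of the nonzero squares and
      contains 3, so the witness here is 5.\<close>
    case 7 then show ?thesis using ge_3[of 48 5] by (simp add: cong_def)
  qed
  then show ?thesis using max_colors_prime_le_3[OF assms(1)] by simp
qed

lemma aw_prime_less_100: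
  assumes p: "prime p" "odd p" "p < 100"
  shows "aw p (Zmod p) 3 = 4 \<longleftrightarrow> p \<in> Q4" "aw p (Zmod p) 3 = 3 \<longleftrightarrow> p \<in> Q3"
proof -
  have aw: "aw p (Zmod p) 3 = max_colors p + 1" using p(1) prime_gt_0_nat by (intro aw_eq_max_colors) auto
  have Q3: "p \<in> Q3 \<longleftrightarrow> p \<notin> Q4" using p by (simp add: Q3_def)
  have "max_colors p = (if p \<in> Q4 then 3 else 2)"
    using odd_primes_less_100[OF p] max_colors_Q3[OF p(1)] max_colors_Q4[OF p(1)] by (metis UnE)
  then show "aw p (Zmod p) 3 = 4 \<longleftrightarrow> p \<in> Q4" "aw p (Zmod p) 3 = 3 \<longleftrightarrow> p \<in> Q3"
    using aw Q3 by auto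
qed

theorem theorem1p6:
  shows "(\<forall>p::nat. prime p \<longrightarrow> 3 \<le> aw p (Zmod p) 3 \<and> aw p (Zmod p) 3 \<le> 4) \<and>
         (\<forall>n::nat. n \<ge> 2 \<longrightarrow> aw n (Zmod n) 3 = 2 + f2 n + f3 n + 2 * f4 n) \<and>
         (\<forall>n::nat. n \<ge> 2 \<longrightarrow> (\<forall>p. prime p \<and> p dvd n \<longrightarrow> p < 100) \<longrightarrow>
            f4 n = size {#p \<in># prime_factorization n. odd p \<and> p \<in> Q4#} \<and>
            f3 n = size {#p \<in># prime_factorization n. odd p \<and> p \<in> Q3#})"
proof (intro conjI allI impI)
  fix p :: nat assume p: "prime p"
  have p2: "p \<ge> 2" using p prime_ge_2_nat by blast
  then have aw: "aw p (Zmod p) 3 = max_colors p + 1" by (intro aw_eq_max_colors) simp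
  show "3 \<le> aw p (Zmod p) 3" using aw max_colors_ge_2[OF p2] by simp
  show "aw p (Zmod p) 3 \<le> 4" using aw max_colors_prime_le_3[OF p] by simp
next
  fix n :: nat assume "n \<ge> 2"
  then show "aw n (Zmod n) 3 = 2 + f2 n + f3 n + 2 * f4 n"
    using aw_eq_max_colors[of n] max_colors_eq[of n] by simp
next
  fix n :: nat assume n: "n \<ge> 2" and small: "\<forall>p. prime p \<and> p dvd n \<longrightarrow> p < 100"
  have pr: "prime p \<and> p < 100" if "p \<in># prime_factorization n" for p
    using that small by (auto simp: in_prime_factors_iff)
  have "{#p \<in># prime_factorization n. odd p \<and> aw p (Zmod p) 3 = 4#}
      = {#p \<in># prime_factorization n. odd p \<and> p \<in> Q4#}"
    by (rule filter_mset_cong[OF refl]) (use pr aw_prime_less_100(1) in blast)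
  then show "f4 n = size {#p \<in># prime_factorization n. odd p \<and> p \<in> Q4#}" by (simp add: f4_def)
  have "{#p \<in># prime_factorization n. odd p \<and> aw p (Zmod p) 3 = 3#}
      = {#p \<in># prime_factorization n. odd p \<and> p \<in> Q3#}"
    by (rule filter_mset_cong[OF refl]) (use pr aw_prime_less_100(2) in blast)
  then show "f3 n = size {#p \<in># prime_factorization n. odd p \<and> p \<in> Q3#}" by (simp add: f3_def)
qed

end
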